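(* Let $V$ be a finite-dimensional faithful complex representation of a finite group $G$, and let $\mathcal{N}(V)$ denote the polynomial model for $G$ associated to $V$. For an irreducible complex representation $U$ of $G$, let $p(U)$ be the smallest integer such that $U$ is isomorphic to a subrepresentation of $\mathcal{A}_{p(U)}$, and let $C_U$ denote the $U$-isotypical component of $\mathcal{A}_{p(U)}$. Then $$\mathcal{N}(V) = \bigoplus_U C_U,$$ where the sum runs over the isomorphism classes of irreducible complex representations $U$ of $G$.
   Context: Let $\mathcal{A}$ be the ring of complex valued polynomial functions on $V$, with $G$-action $(g\cdot P)(v) = P(g^{-1}\cdot v)$, and let $\mathcal{A}_m$ be the ($G$-stable) subspace of homogeneous polynomials of degree $m\ge 0$. (Every irreducible representation of $G$ occurs in some $\mathcal{A}_m$, so $p(U)$ is well defined.) Let $\mathcal{W}$ be the Weyl algebra of differential operators on $\mathcal{A}$ with polynomial coefficients, with $G$-action $(g\cdot D)(P) = g\cdot(D(g^{-1}\cdot P))$. After choosing a basis of $V$, $\mathcal{A} = \mathbb{C}[x_1,\dots,x_n]$ and every $D\in\mathcal{W}$ is uniquely a finite sum $D=\sum c_{\alpha,\beta}x^\alpha\partial^\beta$, with $\partial_i = \partial/\partial x_i$; its degree is $\deg(D) = \max\{\sum_i(\alpha_i-\beta_i) : c_{\alpha,\beta}\neq 0\}$. Let $\mathcal{Z}$ be the set of $G$-invariant elements of $\mathcal{W}$ of negative degree. The polynomial model for $G$ associated to $V$ is the $G$-stable subspace $\mathcal{N}(V) = \{P\in\mathcal{A} : D(P)=0 \text{ for all }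 D\in\mathcal{Z}\}$. *)

theory Defs
  imports "HOL-Analysis.Analysis" "HOL-Algebra.Group" "HOL-Library.Function_Algebras"
begin

section \<open>Complex representations on subspaces\<close>

text \<open>
  A complex vector space is a subspace \<open>E\<close> of an ambient type with scalar multiplication \<open>sc\<close>.
  A representation is a pair of such an \<open>E\<close> and a map \<open>\<tau>\<close> of which only the values
  \<open>\<tau> g x\<close> with \<open>g \<in> carrier G\<close> and \<open>x \<in> E\<close> matter.
\<close>

definition linear_between ::
  "(complex \<Rightarrow> 'a::ab_group_add \<Rightarrow> 'a) \<Rightarrow> 'a set \<Rightarrow> (complex \<Rightarrow> 'b::ab_group_add \<Rightarrow> 'b) \<Rightarrow> 'b set \<Rightarrow>
    ('a \<Rightarrow> 'b) \<Rightarrow> bool" where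
  "linear_between sc E sc' E' f \<longleftrightarrow>
     f ` E \<subseteq> E' \<and>
     (\<forall>x\<in>E. \<forall>y\<in>E. f (x + y) = f x + f y) \<and>
     (\<forall>c. \<forall>x\<in>E. f (sc c x) = sc' c (f x))"

definition group_rep ::
  "('g, 'r) monoid_scheme \<Rightarrow> (complex \<Rightarrow> 'a::ab_group_add \<Rightarrow> 'a) \<Rightarrow> 'a set \<Rightarrow> ('g \<Rightarrow> 'a \<Rightarrow> 'a) \<Rightarrow> bool"
  where
  "group_rep G sc E \<tau> \<longleftrightarrow>
     vector_space sc \<and> module.subspace sc E \<and>
     (\<forall>g\<in>carrier G. linear_between sc E sc E (\<tau> g)) \<and>
     (\<forall>x\<in>E. \<tau> \<one>\<^bsub>G\<^esub> x = x) \<and>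
     (\<forall>g\<in>carrier G. \<forall>h\<in>carrier G. \<forall>x\<in>E. \<tau> (g \<otimes>\<^bsub>G\<^esub> h) x = \<tau> g (\<tau> h x))"

definition subrep ::
  "('g, 'r) monoid_scheme \<Rightarrow> (complex \<Rightarrow> 'a::ab_group_add \<Rightarrow> 'a) \<Rightarrow> 'a set \<Rightarrow> 'a set \<Rightarrow> ('g \<Rightarrow> 'a \<Rightarrow> 'a) \<Rightarrow> bool"
  where
  "subrep G sc F E \<tau> \<longleftrightarrow>
     module.subspace sc F \<and> F \<subseteq> E \<and> (\<forall>g\<in>carrier G. \<tau> g ` F \<subseteq> F)"

definition irreducible_rep ::
  "('g, 'r) monoid_scheme \<Rightarrow> (complex \<Rightarrow> 'a::ab_group_add \<Rightarrow> 'a) \<Rightarrow> 'a set \<Rightarrow> ('g \<Rightarrow> 'a \<Rightarrow> 'a) \<Rightarrow> bool"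
  where
  "irreducible_rep G sc E \<tau> \<longleftrightarrow>
     group_rep G sc E \<tau> \<and> E \<noteq> {0} \<and> (\<forall>F. subrep G sc F E \<tau> \<longrightarrow> F = {0} \<or> F = E)"

definition iso_rep ::
  "('g, 'r) monoid_scheme \<Rightarrow>
    (complex \<Rightarrow> 'a::ab_group_add \<Rightarrow> 'a) \<Rightarrow> 'a set \<Rightarrow> ('g \<Rightarrow> 'a \<Rightarrow> 'a) \<Rightarrow>
    (complex \<Rightarrow> 'b::ab_group_add \<Rightarrow> 'b) \<Rightarrow> 'b set \<Rightarrow> ('g \<Rightarrow> 'b \<Rightarrow> 'b) \<Rightarrow> bool" where
  "iso_rep G sc E \<tau> sc' E' \<tau>' \<longleftrightarrow>
     (\<exists>\<phi>. bij_betw \<phi> E E' \<and> linear_between sc E sc' E' \<phi> \<and>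
          (\<forall>g\<in>carrier G. \<forall>x\<in>E. \<phi> (\<tau> g x) = \<tau>' g (\<phi> x)))"

text \<open>The isotypical component in \<open>(E, \<tau>)\<close> of an irreducible \<open>(E', \<tau>')\<close>:
  the sum of all subrepresentations of \<open>E\<close> isomorphic to \<open>E'\<close>.\<close>

definition isotypical_component ::
  "('g, 'r) monoid_scheme \<Rightarrow>
    (complex \<Rightarrow> 'b::ab_group_add \<Rightarrow> 'b) \<Rightarrow> 'b set \<Rightarrow> ('g \<Rightarrow> 'b \<Rightarrow> 'b) \<Rightarrow>
    (complex \<Rightarrow> 'a::ab_group_add \<Rightarrow> 'a) \<Rightarrow> 'a set \<Rightarrow> ('g \<Rightarrow> 'a \<Rightarrow> 'a) \<Rightarrow> 'a set" where
  "isotypical_component G sc' E' \<tau>' sc E \<tau> =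
     module.span sc (\<Union> {F. subrep G sc F E \<tau> \<and> iso_rep G sc' E' \<tau>' sc F \<tau>})"

text \<open>\<open>N\<close> is the internal direct sum of the subspaces \<open>C i\<close>, \<open>i \<in> I\<close>: every element of \<open>N\<close> is
  in exactly one way a sum of a finitely supported family of elements of the \<open>C i\<close>, and
  all these sums lie in \<open>N\<close>.\<close>

definition internal_direct_sum ::
  "(complex \<Rightarrow> 'a::ab_group_add \<Rightarrow> 'a) \<Rightarrow> 'i set \<Rightarrow> ('i \<Rightarrow> 'a set) \<Rightarrow> 'a set \<Rightarrow> bool" where
  "internal_direct_sum sc I C N \<longleftrightarrow>
     (\<forall>i\<in>I. module.subspace sc (C i)) \<and>
     bij_betw (\<lambda>f. \<Sum>i | f i \<noteq> 0. f i)
       {f. (\<forall>i\<in>I. f i \<in> C i) \<and> (\<forall>i. i \<notin> I \<longrightarrow> f i = 0) \<and> finite {i. f i \<noteq> 0}} N"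

definition fun_scale :: "complex \<Rightarrow> ('a \<Rightarrow> complex) \<Rightarrow> 'a \<Rightarrow> complex" where
  "fun_scale c f = (\<lambda>x. c * f x)"

lemma vector_space_fun_scale: "vector_space fun_scale"
  by unfold_locales (auto simp: fun_scale_def fun_eq_iff algebra_simps)

text \<open>The isomorphism classes of irreducible representations of \<open>G\<close> are taken among the
  representations on subspaces of \<open>nat \<Rightarrow> complex\<close>. For finite \<open>G\<close> this is no
  restriction, as irreducible representations are finite-dimensional.\<close>

type_synonym 'g model_rep = "(nat \<Rightarrow> complex) set \<times> ('g \<Rightarrow> (nat \<Rightarrow> complex) \<Rightarrow> (nat \<Rightarrow> complex))"

definition irreps :: "('g, 'r) monoid_scheme \<Rightarrow> 'g model_rep set" where
  "irreps G = {U. irreducible_rep G fun_scale (fst U) (snd U)}"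

definition irrep_representatives :: "('g, 'r) monoid_scheme \<Rightarrow> 'g model_rep set \<Rightarrow> bool" where
  "irrep_representatives G R \<longleftrightarrow>
     R \<subseteq> irreps G \<and>
     (\<forall>U\<in>irreps G. \<exists>!U'\<in>R. iso_rep G fun_scale (fst U) (snd U) fun_scale (fst U') (snd U'))"


section \<open>Polynomial functions\<close>

text \<open>In the following, \<open>bs\<close> is an ordered basis of the vector space \<open>V\<close>, which is the whole
  type \<open>'v\<close> with scalar multiplication \<open>sc\<close>.\<close>

definition coordinate :: "(complex \<Rightarrow> 'v::ab_group_add \<Rightarrow> 'v) \<Rightarrow> 'v list \<Rightarrow> nat \<Rightarrow> 'v \<Rightarrow> complex" where
  "coordinate sc bs i v = module.representation sc (set bs) v (bs ! i)"

definition multi_indices :: "nat \<Rightarrow> (nat \<Rightarrow> nat) set" where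
  "multi_indices n = {\<alpha>. \<forall>i\<ge>n. \<alpha> i = 0}"

definition mono_fun ::
  "(complex \<Rightarrow> 'v::ab_group_add \<Rightarrow> 'v) \<Rightarrow> 'v list \<Rightarrow> (nat \<Rightarrow> nat) \<Rightarrow> 'v \<Rightarrow> complex" where
  "mono_fun sc bs \<alpha> = (\<lambda>v. \<Prod>i<length bs. coordinate sc bs i v ^ \<alpha> i)"

definition poly_funs :: "(complex \<Rightarrow> 'v::ab_group_add \<Rightarrow> 'v) \<Rightarrow> 'v list \<Rightarrow> ('v \<Rightarrow> complex) set" where
  "poly_funs sc bs = module.span fun_scale (mono_fun sc bs ` multi_indices (length bs))"

definition homog_funs ::
  "(complex \<Rightarrow> 'v::ab_group_add \<Rightarrow> 'v) \<Rightarrow> 'v list \<Rightarrow> nat \<Rightarrow> ('v \<Rightarrow> complex) set" where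
  "homog_funs sc bs m =
     module.span fun_scale
       (mono_fun sc bs ` {\<alpha> \<in> multi_indices (length bs). (\<Sum>i<length bs. \<alpha> i) = m})"

definition fun_act ::
  "('g, 'r) monoid_scheme \<Rightarrow> ('g \<Rightarrow> 'v \<Rightarrow> 'v) \<Rightarrow> 'g \<Rightarrow> ('v \<Rightarrow> complex) \<Rightarrow> 'v \<Rightarrow> complex" where
  "fun_act G \<rho> g P = (\<lambda>v. P (\<rho> (inv\<^bsub>G\<^esub> g) v))"


section \<open>The Weyl algebra\<close>

definition partial_deriv ::
  "(complex \<Rightarrow> 'v::ab_group_add \<Rightarrow> 'v) \<Rightarrow> 'v list \<Rightarrow> nat \<Rightarrow> ('v \<Rightarrow> complex) \<Rightarrow> 'v \<Rightarrow> complex" where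
  "partial_deriv sc bs i P = (\<lambda>v. deriv (\<lambda>t. P (v + sc t (bs ! i))) 0)"

definition partial_derivs ::
  "(complex \<Rightarrow> 'v::ab_group_add \<Rightarrow> 'v) \<Rightarrow> 'v list \<Rightarrow> (nat \<Rightarrow> nat) \<Rightarrow> ('v \<Rightarrow> complex) \<Rightarrow> 'v \<Rightarrow> complex" where
  "partial_derivs sc bs \<beta> = foldr (\<lambda>i D. (partial_deriv sc bs i ^^ \<beta> i) \<circ> D) [0..<length bs] id"

definition weyl_coeffs :: "nat \<Rightarrow> ((nat \<Rightarrow> nat) \<times> (nat \<Rightarrow> nat) \<Rightarrow> complex) set" where
  "weyl_coeffs n =
     {c. finite {p. c p \<noteq> 0} \<and> {p. c p \<noteq> 0} \<subseteq> multi_indices n \<times> multi_indices n}"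

text \<open>Differential operators are regarded as operators on \<open>poly_funs sc bs\<close>. They are made
  extensional by \<open>restrict\<close>, so that HOL equality is equality of operators on polynomials.\<close>

definition weyl_op ::
  "(complex \<Rightarrow> 'v::ab_group_add \<Rightarrow> 'v) \<Rightarrow> 'v list \<Rightarrow> ((nat \<Rightarrow> nat) \<times> (nat \<Rightarrow> nat) \<Rightarrow> complex) \<Rightarrow>
    ('v \<Rightarrow> complex) \<Rightarrow> 'v \<Rightarrow> complex" where
  "weyl_op sc bs c =
     restrict
       (\<lambda>P. \<Sum>(\<alpha>, \<beta>) | c (\<alpha>, \<beta>) \<noteq> 0.
              fun_scale (c (\<alpha>, \<beta>)) (mono_fun sc bs \<alpha> * partial_derivs sc bs \<beta> P))
       (poly_funs sc bs)"

definition weyl_algebra ::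
  "(complex \<Rightarrow> 'v::ab_group_add \<Rightarrow> 'v) \<Rightarrow> 'v list \<Rightarrow> (('v \<Rightarrow> complex) \<Rightarrow> 'v \<Rightarrow> complex) set" where
  "weyl_algebra sc bs = weyl_op sc bs ` weyl_coeffs (length bs)"

text \<open>The coefficients of an operator are unique, so \<open>the_inv_into\<close> recovers them.
  The zero operator has degree \<open>-\<infinity>\<close>, the supremum of the empty set; for the other
  operators the supremum is a maximum.\<close>

definition weyl_degree ::
  "(complex \<Rightarrow> 'v::ab_group_add \<Rightarrow> 'v) \<Rightarrow> 'v list \<Rightarrow> (('v \<Rightarrow> complex) \<Rightarrow> 'v \<Rightarrow> complex) \<Rightarrow> ereal" where
  "weyl_degree sc bs D =
     (let c = the_inv_into (weyl_coeffs (length bs)) (weyl_op sc bs) D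
      in SUP (\<alpha>, \<beta>) \<in> {p. c p \<noteq> 0}. ereal (\<Sum>i<length bs. real (\<alpha> i) - real (\<beta> i)))"

definition op_act ::
  "('g, 'r) monoid_scheme \<Rightarrow> (complex \<Rightarrow> 'v::ab_group_add \<Rightarrow> 'v) \<Rightarrow> 'v list \<Rightarrow> ('g \<Rightarrow> 'v \<Rightarrow> 'v) \<Rightarrow> 'g \<Rightarrow>
    (('v \<Rightarrow> complex) \<Rightarrow> 'v \<Rightarrow> complex) \<Rightarrow> ('v \<Rightarrow> complex) \<Rightarrow> 'v \<Rightarrow> complex" where
  "op_act G sc bs \<rho> g D =
     restrict (\<lambda>P. fun_act G \<rho> g (D (fun_act G \<rho> (inv\<^bsub>G\<^esub> g) P))) (poly_funs sc bs)"

definition neg_invariant_ops ::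
  "('g, 'r) monoid_scheme \<Rightarrow> (complex \<Rightarrow> 'v::ab_group_add \<Rightarrow> 'v) \<Rightarrow> 'v list \<Rightarrow> ('g \<Rightarrow> 'v \<Rightarrow> 'v) \<Rightarrow>
    (('v \<Rightarrow> complex) \<Rightarrow> 'v \<Rightarrow> complex) set" where
  "neg_invariant_ops G sc bs \<rho> =
     {D \<in> weyl_algebra sc bs.
        (\<forall>g\<in>carrier G. op_act G sc bs \<rho> g D = D) \<and> weyl_degree sc bs D < 0}"


section \<open>The polynomial model\<close>

definition polynomial_model ::
  "('g, 'r) monoid_scheme \<Rightarrow> (complex \<Rightarrow> 'v::ab_group_add \<Rightarrow> 'v) \<Rightarrow> 'v list \<Rightarrow> ('g \<Rightarrow> 'v \<Rightarrow> 'v) \<Rightarrow>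
    ('v \<Rightarrow> complex) set" where
  "polynomial_model G sc bs \<rho> = {P \<in> poly_funs sc bs. \<forall>D\<in>neg_invariant_ops G sc bs \<rho>. D P = 0}"

definition first_degree ::
  "('g, 'r) monoid_scheme \<Rightarrow> (complex \<Rightarrow> 'v::ab_group_add \<Rightarrow> 'v) \<Rightarrow> 'v list \<Rightarrow> ('g \<Rightarrow> 'v \<Rightarrow> 'v) \<Rightarrow>
    'g model_rep \<Rightarrow> nat" where
  "first_degree G sc bs \<rho> U =
     (LEAST m. \<exists>F. subrep G fun_scale F (homog_funs sc bs m) (fun_act G \<rho>) \<and>
                   iso_rep G fun_scale (fst U) (snd U) fun_scale F (fun_act G \<rho>))"

definition first_component ::
  "('g, 'r) monoid_scheme \<Rightarrow> (complex \<Rightarrow> 'v::ab_group_add \<Rightarrow> 'v) \<Rightarrow> 'v list \<Rightarrow> ('g \<Rightarrow> 'v \<Rightarrow> 'v) \<Rightarrow>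
    'g model_rep \<Rightarrow> ('v \<Rightarrow> complex) set" where
  "first_component G sc bs \<rho> U =
     isotypical_component G fun_scale (fst U) (snd U)
       fun_scale (homog_funs sc bs (first_degree G sc bs \<rho> U)) (fun_act G \<rho>)"

end

theory Submission
  imports Defs
begin

text \<open>
  An invariant operator of negative degree maps a copy of \<open>U\<close> in degree \<open>p(U)\<close> equivariantly into
  lower degrees, where \<open>U\<close> does not occur, so it kills \<open>C\<^sub>U\<close>. Conversely, every equivariant linear
  map \<open>\<phi>\<close> from \<open>\<A>\<^sub>m\<close> to \<open>\<A>\<^sub>k\<close> with \<open>k < m\<close> extends to such an operator \<open>D\<close>: evaluate at \<open>v\<close> the
  image under \<open>\<phi>\<close> of the degree \<open>m\<close> term of the Taylor expansion at \<open>v\<close>. The degree \<open>k\<close>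
  part of \<open>D P\<close> is \<open>\<phi>(P\<^sub>m)\<close>, so for \<open>P\<close> in the polynomial model the component \<open>P\<^sub>m\<close> is killed by all
  these \<open>\<phi>\<close>. By Maschke's theorem \<open>P\<^sub>m\<close> is then a sum of elements of irreducible
  subrepresentations that do not occur in degrees below \<open>m\<close>.
\<close>

section \<open>Representations of finite groups\<close>

text \<open>The extension works because \<open>D P\<close> is the sum, over \<open>\<beta>\<close>
  of degree \<open>m\<close>, of \<open>pd \<beta> P\<close> times
  \<open>\<phi> (M \<beta>)\<close>, divided by the factorials of \<open>\<beta>\<close>. Each
  \<open>\<phi> (M \<beta>)\<close> has degree \<open>k\<close>, so in degree \<open>k\<close> only
  the constant term of \<open>pd \<beta> P\<close> survives, and that is a factorial times a
  coefficient of \<open>P\<close>. The obstacle is invariance, which cannot be seen from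
  coefficients in a basis. The value of \<open>D P\<close> at \<open>v\<close> through the translate
  of \<open>P\<close> by \<open>v\<close> reduces it to the compatibility of the action with
  translations and with graded parts. In the other direction \<open>D\<close> need not be
  homogeneous, so \<open>D P\<close> is cut into graded parts; cutting is equivariant, and Schur's
  lemma applies to any nonzero part. Degrees alone do not make the sum direct, since different
  \<open>U\<close> may have the same p(U). Instead, an irreducible subspace common to one component
  and the span of the others would be isomorphic to two different representatives. Maschke
  projections are taken on the space of all functions on V; the finite dimension of the graded
  pieces yields irreducible subspaces and drives the induction.\<close>

lemma linear_between_zero:
  assumes "linear_between sc E sc' E' f" "vector_space sc" "module.subspace sc E"
  shows "f 0 = 0"
proof -
  interpret s: vector_space sc by fact
  have "0 \<in> E" using assms(3) by (rule s.subspace_0)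
  then have "f (0 + 0) = f 0 + f 0"
    using assms(1) unfolding linear_between_def by blast
  then show ?thesis by simp
qed

lemma linear_between_add:
  "linear_between sc E sc' E' f \<Longrightarrow> x \<in> E \<Longrightarrow> y \<in> E \<Longrightarrow> f (x + y) = f x + f y"
  unfolding linear_between_def by blast

lemma linear_between_scale:
  "linear_between sc E sc' E' f \<Longrightarrow> x \<in> E \<Longrightarrow> f (sc c x) = sc' c (f x)"
  unfolding linear_between_def by blast

lemma linear_between_in:
  "linear_between sc E sc' E' f \<Longrightarrow> x \<in> E \<Longrightarrow> f x \<in> E'"
  unfolding linear_between_def by blast

lemma linear_between_diff:
  assumes "linear_between sc E sc' E' f" "vector_space sc" "module.subspace sc E" "x \<in> E" "y \<in> E"
  shows "f (x - y) = f x - f y"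
proof -
  interpret s: vector_space sc by fact
  have "x - y \<in> E" using assms by (simp add: s.subspace_diff)
  then have "f ((x - y) + y) = f (x - y) + f y"
    using assms(1,5) by (intro linear_between_add)
  then show ?thesis by simp
qed

lemma linear_between_sum:
  assumes "linear_between sc E sc' E' f" "vector_space sc" "module.subspace sc E"
    and "\<And>i. i \<in> I \<Longrightarrow> g i \<in> E"
  shows "f (\<Sum>i\<in>I. g i) = (\<Sum>i\<in>I. f (g i))"
  using assms(4)
proof (induction I rule: infinite_finite_induct)
  interpret s: vector_space sc by fact
  case (insert i I)
  have "(\<Sum>i\<in>I. g i) \<in> E" using insert assms(3) by (intro s.subspace_sum) auto
  then show ?case using insert linear_between_add[OF assms(1)] by simp
qed (use linear_between_zero[OF assms(1-3)] in simp_all)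

lemma linear_between_compose:
  assumes "linear_between sc E sc' E' f" "linear_between sc' E' sc'' E'' g"
  shows "linear_between sc E sc'' E'' (\<lambda>x. g (f x))"
  using assms unfolding linear_between_def by (auto simp: image_subset_iff)

lemma linear_between_mono:
  assumes "linear_between sc E sc' E' f" "F \<subseteq> E" "f ` F \<subseteq> F'"
  shows "linear_between sc F sc' F' f"
  using assms unfolding linear_between_def by blast

lemma linear_between_image_subspace:
  assumes "linear_between sc E sc' E' f" "vector_space sc" "vector_space sc'"
    "module.subspace sc E"
  shows "module.subspace sc' (f ` E)"
proof -
  interpret s: vector_space sc by fact
  interpret s': vector_space sc' by fact
  show ?thesis
  proof (rule s'.subspaceI)
    show "0 \<in> f ` E"
      using linear_between_zero[OF assms(1,2,4)] s.subspace_0[OF assms(4)] by force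
  next
    fix x y assume "x \<in> f ` E" "y \<in> f ` E"
    then show "x + y \<in> f ` E"
      using linear_between_add[OF assms(1)] s.subspace_add[OF assms(4)]
      by (auto simp: image_iff) metis
  next
    fix c x assume "x \<in> f ` E"
    then show "sc' c x \<in> f ` E"
      using linear_between_scale[OF assms(1)] s.subspace_scale[OF assms(4)]
      by (auto simp: image_iff) metis
  qed
qed

lemma linear_between_kernel_subspace:
  assumes "linear_between sc E sc' E' f" "vector_space sc" "vector_space sc'"
    "module.subspace sc E"
  shows "module.subspace sc {x \<in> E. f x = 0}"
proof -
  interpret s: vector_space sc by fact
  interpret s': vector_space sc' by fact
  show ?thesis
    by (rule s.subspaceI)
      (use linear_between_zero[OF assms(1,2,4)] linear_between_add[OF assms(1)]
        linear_between_scale[OF assms(1)] assms(4) in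
        \<open>auto simp: s.subspace_0 s.subspace_add s.subspace_scale\<close>)
qed

lemma linear_between_inj_onI:
  assumes "linear_between sc E sc' E' f" "vector_space sc" "module.subspace sc E"
    and "\<And>x. x \<in> E \<Longrightarrow> f x = 0 \<Longrightarrow> x = 0"
  shows "inj_on f E"
proof (rule inj_onI)
  interpret s: vector_space sc by fact
  fix x y assume xy: "x \<in> E" "y \<in> E" "f x = f y"
  then have "f (x - y) = 0" using linear_between_diff[OF assms(1-3)] by simp
  then have "x - y = 0" using assms(4) s.subspace_diff[OF assms(3) xy(1,2)] by blast
  then show "x = y" by simp
qed

section \<open>Isomorphisms, transported actions and Schur's lemma\<close>

lemma iso_rep_refl: "iso_rep G sc E \<tau> sc E \<tau>"
  unfolding iso_rep_def linear_between_def by (rule exI[of _ id]) auto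

lemma iso_rep_trans:
  assumes "iso_rep G sc E \<tau> sc' E' \<tau>'" "iso_rep G sc' E' \<tau>' sc'' E'' \<tau>''"
  shows "iso_rep G sc E \<tau> sc'' E'' \<tau>''"
proof -
  obtain f where f: "bij_betw f E E'" "linear_between sc E sc' E' f"
    "\<forall>g\<in>carrier G. \<forall>x\<in>E. f (\<tau> g x) = \<tau>' g (f x)"
    using assms(1) unfolding iso_rep_def by blast
  obtain h where h: "bij_betw h E' E''" "linear_between sc' E' sc'' E'' h"
    "\<forall>g\<in>carrier G. \<forall>x\<in>E'. h (\<tau>' g x) = \<tau>'' g (h x)"
    using assms(2) unfolding iso_rep_def by blast
  have "bij_betw (\<lambda>x. h (f x)) E E''"
    using bij_betw_trans[OF f(1) h(1)] by (simp add: comp_def)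
  moreover have "\<forall>g\<in>carrier G. \<forall>x\<in>E. h (f (\<tau> g x)) = \<tau>'' g (h (f x))"
    using f h linear_between_in[OF f(2)] by simp
  ultimately show ?thesis
    unfolding iso_rep_def using linear_between_compose[OF f(2) h(2)] by blast
qed

lemma group_rep_in: "group_rep G sc E \<tau> \<Longrightarrow> g \<in> carrier G \<Longrightarrow> x \<in> E \<Longrightarrow> \<tau> g x \<in> E"
  unfolding group_rep_def linear_between_def by blast

lemma group_rep_linear: "group_rep G sc E \<tau> \<Longrightarrow> g \<in> carrier G \<Longrightarrow> linear_between sc E sc E (\<tau> g)"
  unfolding group_rep_def by blast

lemma group_rep_inv:
  assumes "group G" "group_rep G sc E \<tau>" "g \<in> carrier G" "x \<in> E"
  shows "\<tau> g (\<tau> (inv\<^bsub>G\<^esub> g) x) = x" "\<tau> (inv\<^bsub>G\<^esub> g) (\<tau> g x) = x"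
proof -
  interpret group G by fact
  have "\<tau> (g \<otimes>\<^bsub>G\<^esub> inv\<^bsub>G\<^esub> g) x = \<tau> g (\<tau> (inv\<^bsub>G\<^esub> g) x)"
    "\<tau> (inv\<^bsub>G\<^esub> g \<otimes>\<^bsub>G\<^esub> g) x = \<tau> (inv\<^bsub>G\<^esub> g) (\<tau> g x)" "\<tau> \<one>\<^bsub>G\<^esub> x = x"
    using assms unfolding group_rep_def by (meson inv_closed)+
  then show "\<tau> g (\<tau> (inv\<^bsub>G\<^esub> g) x) = x" "\<tau> (inv\<^bsub>G\<^esub> g) (\<tau> g x) = x"
    using assms(3) by simp_all
qed

lemma group_rep_subrep:
  assumes "group_rep G sc E \<tau>" "subrep G sc F E \<tau>"
  shows "group_rep G sc F \<tau>"
proof -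
  have F: "module.subspace sc F" "F \<subseteq> E" "\<And>g. g \<in> carrier G \<Longrightarrow> \<tau> g ` F \<subseteq> F"
    using assms(2) unfolding subrep_def by blast+
  have "linear_between sc F sc F (\<tau> g)" if "g \<in> carrier G" for g
    by (rule linear_between_mono[OF group_rep_linear[OF assms(1) that] F(2) F(3)[OF that]])
  moreover have "vector_space sc" "\<And>x. x \<in> F \<Longrightarrow> \<tau> \<one>\<^bsub>G\<^esub> x = x"
    "\<And>g h x. g \<in> carrier G \<Longrightarrow> h \<in> carrier G \<Longrightarrow> x \<in> F \<Longrightarrow> \<tau> (g \<otimes>\<^bsub>G\<^esub> h) x = \<tau> g (\<tau> h x)"
    using assms(1) subsetD[OF F(2)] unfolding group_rep_def by simp_all
  ultimately show ?thesis using F(1) unfolding group_rep_def by blast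
qed

lemma subrep_refl: "group_rep G sc E \<tau> \<Longrightarrow> subrep G sc E E \<tau>"
  unfolding subrep_def group_rep_def linear_between_def by simp

lemma subrep_trans:
  assumes "subrep G sc F E \<tau>" "subrep G sc F' F \<tau>"
  shows "subrep G sc F' E \<tau>"
  using assms unfolding subrep_def by blast

text \<open>The representation structure keeps sums, multiples and translates of preimages inside
  \<open>E\<close>; there the inverse map undoes \<open>f\<close>, so each identity for the inverse
  can be checked after applying \<open>f\<close>.\<close>

lemma iso_rep_sym:
  assumes "iso_rep G sc E \<tau> sc' E' \<tau>'" "group_rep G sc E \<tau>"
  shows "iso_rep G sc' E' \<tau>' sc E \<tau>"
proof -
  interpret s: vector_space sc using assms(2) unfolding group_rep_def by blast
  have subE: "s.subspace E" using assms(2) unfolding group_rep_def by blast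
  obtain f where f: "bij_betw f E E'" "linear_between sc E sc' E' f"
    "\<forall>g\<in>carrier G. \<forall>x\<in>E. f (\<tau> g x) = \<tau>' g (f x)"
    using assms(1) unfolding iso_rep_def by blast
  define h where "h = inv_into E f"
  have h: "bij_betw h E' E" unfolding h_def using f(1) by (rule bij_betw_inv_into)
  have hE: "h y \<in> E" if "y \<in> E'" for y using h that by (simp add: bij_betw_apply)
  have hf: "h (f x) = x" if "x \<in> E" for x
    unfolding h_def using f(1) that by (simp add: bij_betw_inv_into_left)
  have fh: "f (h y) = y" if "y \<in> E'" for y
    unfolding h_def using f(1) that by (simp add: bij_betw_inv_into_right)
  have add: "h (x + y) = h x + h y" if "x \<in> E'" "y \<in> E'" for x y
  proof -
    have "f (h x + h y) = x + y" using linear_between_add[OF f(2)] hE fh that by simp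
    then show ?thesis using hf[of "h x + h y"] hE that subE by (simp add: s.subspace_add)
  qed
  have scale: "h (sc' c x) = sc c (h x)" if "x \<in> E'" for c x
  proof -
    have "f (sc c (h x)) = sc' c x" using linear_between_scale[OF f(2)] hE fh that by simp
    then show ?thesis using hf[of "sc c (h x)"] hE that subE by (simp add: s.subspace_scale)
  qed
  have equi: "h (\<tau>' g y) = \<tau> g (h y)" if "g \<in> carrier G" "y \<in> E'" for g y
  proof -
    have "f (\<tau> g (h y)) = \<tau>' g y" using f(3) hE fh that by simp
    then show ?thesis using hf[of "\<tau> g (h y)"] hE that group_rep_in[OF assms(2)] by simp
  qed
  show ?thesis
    unfolding iso_rep_def linear_between_def using h add scale equi hE by blast
qed

text \<open>The laws for \<open>\<tau>'\<close> are not assumed but inherited: every point of the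
  image is some \<open>f x\<close>, and the intertwining identity moves \<open>\<tau>'\<close> to
  \<open>\<tau>\<close> under \<open>f\<close>.\<close>

lemma image_group_rep:
  assumes "linear_between sc E sc' E' f" "group_rep G sc E \<tau>" "vector_space sc'"
    and "\<And>g x. g \<in> carrier G \<Longrightarrow> x \<in> E \<Longrightarrow> f (\<tau> g x) = \<tau>' g (f x)"
    and "group G"
  shows "group_rep G sc' (f ` E) \<tau>'"
proof -
  interpret group G by fact
  have E: "vector_space sc" "module.subspace sc E"
    using assms(2) unfolding group_rep_def by blast+
  interpret s: vector_space sc by fact
  have lin: "linear_between sc' (f ` E) sc' (f ` E) (\<tau>' g)" if g: "g \<in> carrier G" for g
  proof -
    have "\<tau>' g (f x + f y) = \<tau>' g (f x) + \<tau>' g (f y)" if "x \<in> E" "y \<in> E" for x y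
    proof -
      have "\<tau>' g (f x + f y) = f (\<tau> g (x + y))"
        using assms(4) g that E(2) linear_between_add[OF assms(1)] by (simp add: s.subspace_add)
      also have "\<dots> = f (\<tau> g x) + f (\<tau> g y)"
        using that g group_rep_in[OF assms(2)] linear_between_add[OF assms(1)]
          linear_between_add[OF group_rep_linear[OF assms(2) g]] by simp
      finally show ?thesis using assms(4) g that by simp
    qed
    moreover have "\<tau>' g (sc' c (f x)) = sc' c (\<tau>' g (f x))" if "x \<in> E" for c x
    proof -
      have "\<tau>' g (sc' c (f x)) = f (\<tau> g (sc c x))"
        using assms(4) g that E(2) linear_between_scale[OF assms(1)] by (simp add: s.subspace_scale)
      also have "\<dots> = sc' c (f (\<tau> g x))"
        using that g group_rep_in[OF assms(2)] linear_between_scale[OF assms(1)]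
          linear_between_scale[OF group_rep_linear[OF assms(2) g]] by simp
      finally show ?thesis using assms(4) g that by simp
    qed
    moreover have "\<tau>' g (f x) \<in> f ` E" if "x \<in> E" for x
      using assms(4) g that group_rep_in[OF assms(2)] by (metis imageI)
    ultimately show ?thesis unfolding linear_between_def by auto
  qed
  have "\<tau>' \<one>\<^bsub>G\<^esub> (f x) = f x" if "x \<in> E" for x
    using assms(2) assms(4)[of "\<one>\<^bsub>G\<^esub>" x] that unfolding group_rep_def by simp
  moreover have "\<tau>' (g \<otimes>\<^bsub>G\<^esub> h) (f x) = \<tau>' g (\<tau>' h (f x))"
    if "g \<in> carrier G" "h \<in> carrier G" "x \<in> E" for g h x
  proof -
    have "\<tau>' (g \<otimes>\<^bsub>G\<^esub> h) (f x) = f (\<tau> g (\<tau> h x))"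
      using assms(4)[of "g \<otimes>\<^bsub>G\<^esub> h" x] that assms(2) unfolding group_rep_def by simp
    also have "\<dots> = \<tau>' g (\<tau>' h (f x))"
      using assms(4) that group_rep_in[OF assms(2)] by simp
    finally show ?thesis .
  qed
  ultimately show ?thesis
    unfolding group_rep_def
    using assms(3) lin linear_between_image_subspace[OF assms(1) E(1) assms(3) E(2)] by auto
qed

text \<open>Invariant subspaces of the target are pulled back along the inverse isomorphism, where
  irreducibility of the source leaves only two choices.\<close>

lemma iso_rep_irreducible:
  assumes "iso_rep G sc E \<tau> sc' E' \<tau>'" "irreducible_rep G sc E \<tau>" "vector_space sc'" "group G"
  shows "irreducible_rep G sc' E' \<tau>'"
proof -
  have E: "group_rep G sc E \<tau>" using assms(2) unfolding irreducible_rep_def by blast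
  have vs: "vector_space sc" "module.subspace sc E" using E unfolding group_rep_def by blast+
  interpret s: vector_space sc by fact
  interpret s': vector_space sc' by fact
  obtain f where f: "bij_betw f E E'" "linear_between sc E sc' E' f"
    "\<forall>g\<in>carrier G. \<forall>x\<in>E. f (\<tau> g x) = \<tau>' g (f x)"
    using assms(1) unfolding iso_rep_def by blast
  have im: "f ` E = E'" using f(1) by (simp add: bij_betw_def)
  have E': "group_rep G sc' E' \<tau>'"
    using image_group_rep[OF f(2) E assms(3) _ assms(4)] f(3) im by auto
  obtain h where h: "bij_betw h E' E" "linear_between sc' E' sc E h"
    "\<forall>g\<in>carrier G. \<forall>x\<in>E'. h (\<tau>' g x) = \<tau> g (h x)"
    using iso_rep_sym[OF assms(1) E] unfolding iso_rep_def by blast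
  have "E' \<noteq> {0}"
  proof
    assume "E' = {0}"
    then obtain a where "E = {a}"
      using h(1) by (auto simp: bij_betw_def)
    moreover have "0 \<in> E" using vs(2) by (rule s.subspace_0)
    ultimately have "E = {0}" by simp
    then show False using assms(2) unfolding irreducible_rep_def by blast
  qed
  moreover have "F = {0} \<or> F = E'" if F: "subrep G sc' F E' \<tau>'" for F
  proof -
    have FE: "F \<subseteq> E'" and subF: "module.subspace sc' F"
      using F unfolding subrep_def by blast+
    have linF: "linear_between sc' F sc E h"
      by (rule linear_between_mono[OF h(2) FE]) (use linear_between_in[OF h(2)] FE in blast)
    have "module.subspace sc (h ` F)"
      using linear_between_image_subspace[OF linF assms(3) vs(1) subF] .
    moreover have "\<tau> g ` h ` F \<subseteq> h ` F" if "g \<in> carrier G" for g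
    proof -
      have "\<tau> g (h x) \<in> h ` F" if "x \<in> F" for x
        using h(3) \<open>g \<in> carrier G\<close> that F FE unfolding subrep_def
        by (metis image_eqI image_subset_iff subsetD)
      then show ?thesis by blast
    qed
    moreover have "h ` F \<subseteq> E" using linear_between_in[OF linF] by blast
    ultimately have "subrep G sc (h ` F) E \<tau>" unfolding subrep_def by blast
    then consider "h ` F = {0}" | "h ` F = E"
      using assms(2) unfolding irreducible_rep_def by blast
    then show ?thesis
    proof cases
      case 1
      have z: "h 0 = 0" using linear_between_zero[OF linF assms(3) subF] .
      have "0 \<in> F" using subF by (rule s'.subspace_0)
      moreover have "x = 0" if "x \<in> F" for x
      proof -
        have "h x \<in> h ` F" using that by (rule imageI)
        then have "h x = h 0" using 1 z by simp
        then show ?thesis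
          using h(1) that \<open>0 \<in> F\<close> FE by (meson bij_betw_imp_inj_on inj_onD subsetD)
      qed
      ultimately show ?thesis by blast
    next
      case 2
      then have "F = E'" using h(1) FE by (metis bij_betw_def inj_on_image_eq_iff subset_refl)
      then show ?thesis ..
    qed
  qed
  ultimately show ?thesis using E' unfolding irreducible_rep_def by blast
qed

text \<open>This half of Schur's lemma rests on the kernel being a subrepresentation that misses
  \<open>x\<close>. It turns a nonzero equivariant map into a copy of \<open>F\<close> inside the
  target, which is how occurrence of an irreducible in a given degree is detected.\<close>

lemma irreducible_rep_embedding:
  assumes "group G" "irreducible_rep G sc F \<tau>" "group_rep G sc' E \<tau>'" "linear_between sc F sc' E f"
    and "\<And>g x. g \<in> carrier G \<Longrightarrow> x \<in> F \<Longrightarrow> f (\<tau> g x) = \<tau>' g (f x)"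
    and "x \<in> F" "f x \<noteq> 0"
  shows "inj_on f F" "subrep G sc' (f ` F) E \<tau>'" "iso_rep G sc F \<tau> sc' (f ` F) \<tau>'"
proof -
  have F: "group_rep G sc F \<tau>" using assms(2) unfolding irreducible_rep_def by blast
  have vs: "vector_space sc" "module.subspace sc F" "vector_space sc'" "module.subspace sc' E"
    using F assms(3) unfolding group_rep_def by blast+
  define K where "K = {x \<in> F. f x = 0}"
  have t0: "\<tau>' g 0 = 0" if "g \<in> carrier G" for g
    using linear_between_zero[OF group_rep_linear[OF assms(3) that] vs(3,4)] .
  have "subrep G sc K F \<tau>"
    unfolding subrep_def K_def
    using linear_between_kernel_subspace[OF assms(4) vs(1,3,2)] assms(5) t0 group_rep_in[OF F] by auto
  moreover have "K \<noteq> F" using assms(6,7) K_def by blast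
  ultimately have "K = {0}" using assms(2) unfolding irreducible_rep_def by blast
  then show inj: "inj_on f F"
    using K_def by (intro linear_between_inj_onI[OF assms(4) vs(1,2)]) blast
  have gr: "group_rep G sc' (f ` F) \<tau>'"
    by (rule image_group_rep[OF assms(4) F vs(3) _ assms(1)]) (rule assms(5))
  have "module.subspace sc' (f ` F)" using gr unfolding group_rep_def by blast
  then show "subrep G sc' (f ` F) E \<tau>'"
    unfolding subrep_def using linear_between_in[OF assms(4)] group_rep_in[OF gr] by auto
  show "iso_rep G sc F \<tau> sc' (f ` F) \<tau>'"
    unfolding iso_rep_def
  proof (intro exI[of _ f] conjI)
    show "bij_betw f F (f ` F)" using inj by (rule inj_on_imp_bij_betw)
    show "linear_between sc F sc' (f ` F) f" using linear_between_mono[OF assms(4)] by blast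
  qed (use assms(5) in blast)
qed

section \<open>Maschke's theorem and irreducible subspaces\<close>

text \<open>Averages the conjugates of a linear projection over the group. The ambient space is the
  whole type, of any dimension, so that it applies to the space of all functions on V.\<close>

lemma maschke_projection:
  assumes "group G" "finite (carrier G)" "group_rep G sc UNIV \<tau>" "subrep G sc F UNIV \<tau>"
  shows "\<exists>\<pi>. linear_between sc UNIV sc F \<pi> \<and> (\<forall>x\<in>F. \<pi> x = x) \<and>
    (\<forall>g\<in>carrier G. \<forall>x. \<pi> (\<tau> g x) = \<tau> g (\<pi> x))"
proof -
  interpret group G by fact
  interpret s: vector_space sc using assms(3) unfolding group_rep_def by blast
  interpret sp: vector_space_pair sc sc by unfold_locales
  have F: "s.subspace F" "\<And>g x. g \<in> carrier G \<Longrightarrow> x \<in> F \<Longrightarrow> \<tau> g x \<in> F"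
    using assms(4) unfolding subrep_def by blast+
  \<comment> \<open>The identity is injective on \<open>F\<close>, so it has a linear left inverse
    with values in \<open>F\<close>: a linear projection onto \<open>F\<close> that need not be
    equivariant.\<close>
  obtain p where p: "range p \<subseteq> F" "Vector_Spaces.linear sc sc p" "\<forall>v\<in>F. p v = v"
    using sp.linear_exists_left_inverse_on[OF s.linear_id F(1)] by auto
  note tlin = group_rep_linear[OF assms(3)]
  have plin: "linear_between sc UNIV sc F p"
    using p(1) sp.linear_add[OF p(2)] sp.linear_scale[OF p(2)] unfolding linear_between_def by auto
  let ?n = "of_nat (card (carrier G)) :: complex"
  have n: "?n \<noteq> 0" using assms(2) by (auto simp: card_eq_0_iff)
  define q where "q g x = \<tau> g (p (\<tau> (inv\<^bsub>G\<^esub> g) x))" for g x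
  define \<pi> where "\<pi> x = sc (1 / ?n) (\<Sum>g\<in>carrier G. q g x)" for x
  have qlin: "linear_between sc UNIV sc F (q g)" if "g \<in> carrier G" for g
  proof -
    have "linear_between sc F sc F (\<tau> g)"
      using linear_between_mono[OF tlin[OF that]] F(2) that by blast
    then show ?thesis
      unfolding q_def using that
      by (intro linear_between_compose[OF linear_between_compose[OF tlin plin]]) auto
  qed
  have sum_in: "(\<Sum>g\<in>carrier G. q g x) \<in> F" for x
    by (intro s.subspace_sum F(1)) (use linear_between_in[OF qlin] in auto)
  have "linear_between sc UNIV sc F \<pi>"
  proof -
    have "\<pi> (x + y) = \<pi> x + \<pi> y" for x y
    proof -
      have "(\<Sum>g\<in>carrier G. q g (x + y)) = (\<Sum>g\<in>carrier G. q g x + q g y)"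
        by (intro sum.cong refl linear_between_add[OF qlin]) auto
      then show ?thesis unfolding \<pi>_def by (simp add: sum.distrib s.scale_right_distrib)
    qed
    moreover have "\<pi> (sc c x) = sc c (\<pi> x)" for c x
    proof -
      have "(\<Sum>g\<in>carrier G. q g (sc c x)) = (\<Sum>g\<in>carrier G. sc c (q g x))"
        by (intro sum.cong refl linear_between_scale[OF qlin]) auto
      then show ?thesis
        unfolding \<pi>_def by (simp add: s.scale_sum_right[symmetric] s.scale_left_commute)
    qed
    moreover have "\<pi> x \<in> F" for x unfolding \<pi>_def using sum_in F(1) by (simp add: s.subspace_scale)
    ultimately show ?thesis unfolding linear_between_def by auto
  qed
  moreover have "\<pi> x = x" if x: "x \<in> F" for x
  proof -
    \<comment> \<open>\<open>p\<close> fixes the translate of \<open>x\<close> by the inverse of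
      \<open>g\<close>, since that stays in \<open>F\<close>; so each conjugate already fixes
      \<open>F\<close>, and the average does as well.\<close>
    have "q g x = x" if g: "g \<in> carrier G" for g
      using p(3) F(2)[OF inv_closed[OF g] x] group_rep_inv[OF assms(1,3) g] unfolding q_def by simp
    then have "(\<Sum>g\<in>carrier G. q g x) = sc ?n x" by (simp add: s.sum_constant_scale)
    then show ?thesis unfolding \<pi>_def using n by simp
  qed
  moreover have "\<pi> (\<tau> h x) = \<tau> h (\<pi> x)" if h: "h \<in> carrier G" for h x
  proof -
    have mult: "\<tau> (a \<otimes>\<^bsub>G\<^esub> b) y = \<tau> a (\<tau> b y)" if "a \<in> carrier G" "b \<in> carrier G" for a b y
      using assms(3) that unfolding group_rep_def by blast
    \<comment> \<open>Left multiplication by \<open>h\<close> permutes the group; after this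
      substitution \<open>h\<close> can be pulled out of every summand.\<close>
    have "(\<Sum>g\<in>carrier G. q g (\<tau> h x)) = (\<Sum>g\<in>carrier G. q (h \<otimes>\<^bsub>G\<^esub> g) (\<tau> h x))"
      by (rule sum.reindex_bij_betw[symmetric, OF bij_betwI[where g = "\<lambda>g. inv\<^bsub>G\<^esub> h \<otimes>\<^bsub>G\<^esub> g"]])
        (use h in \<open>auto simp: m_assoc[symmetric]\<close>)
    also have "\<dots> = (\<Sum>g\<in>carrier G. \<tau> h (q g x))"
    proof (rule sum.cong[OF refl])
      fix g assume g: "g \<in> carrier G"
      have "\<tau> (inv\<^bsub>G\<^esub> (h \<otimes>\<^bsub>G\<^esub> g)) (\<tau> h x) = \<tau> (inv\<^bsub>G\<^esub> g) x"
        using g h by (simp add: inv_mult_group mult group_rep_inv[OF assms(1,3)])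
      then show "q (h \<otimes>\<^bsub>G\<^esub> g) (\<tau> h x) = \<tau> h (q g x)"
        unfolding q_def using g h by (simp add: mult)
    qed
    also have "\<dots> = \<tau> h (\<Sum>g\<in>carrier G. q g x)"
      by (rule linear_between_sum[OF tlin[OF h], symmetric]) (auto simp: s.vector_space_axioms)
    finally show ?thesis
      unfolding \<pi>_def using linear_between_scale[OF tlin[OF h]] by simp
  qed
  ultimately show ?thesis by blast
qed

text \<open>A basis of \<open>F\<close> extends to a strictly larger one of \<open>E\<close>. The
  finite set \<open>T\<close> bounds these bases; for an infinite basis the cardinality, and with it
  \<open>dim\<close>, would be 0.\<close>

lemma dim_strict_subspace:
  assumes "vector_space sc" "finite T" "E \<subseteq> module.span sc T"
    "module.subspace sc F" "F \<subset> E"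
  shows "vector_space.dim sc F < vector_space.dim sc E"
proof -
  interpret s: vector_space sc by fact
  obtain B where B: "B \<subseteq> F" "s.independent B" "F \<subseteq> s.span B" "card B = s.dim F"
    using s.basis_exists by blast
  obtain B' where B': "B \<subseteq> B'" "B' \<subseteq> E" "s.independent B'" "E \<subseteq> s.span B'"
    using s.maximal_independent_subset_extend[of B E] B(1,2) assms(5) by blast
  have "B' \<noteq> B"
  proof
    assume "B' = B"
    then have "E \<subseteq> F" using B'(4) B(1) s.span_minimal[OF _ assms(4)] by blast
    then show False using assms(5) by blast
  qed
  moreover have "finite B'" using s.independent_span_bound[OF assms(2) B'(3)] B'(2) assms(3) by blast
  ultimately have "card B < card B'" using B'(1) by (metis psubsetI psubset_card_mono)
  then show ?thesis using B(4) s.basis_card_eq_dim[OF B'(2,4,3)] by simp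
qed

text \<open>A reducible \<open>E\<close> has a proper nonzero subrepresentation, of smaller
  dimension, so descent must end at an irreducible one.\<close>

lemma exists_irreducible_subrep:
  assumes "finite T" "E \<subseteq> module.span sc T" "group_rep G sc E \<tau>" "E \<noteq> {0}"
  shows "\<exists>F. subrep G sc F E \<tau> \<and> irreducible_rep G sc F \<tau>"
  using assms(2-)
proof (induction "vector_space.dim sc E" arbitrary: E rule: less_induct)
  case less
  show ?case
  proof (cases "irreducible_rep G sc E \<tau>")
    case True
    then show ?thesis using subrep_refl[OF less.prems(2)] by blast
  next
    case False
    then obtain F where F: "subrep G sc F E \<tau>" "F \<noteq> {0}" "F \<noteq> E"
      using less.prems unfolding irreducible_rep_def by blast
    then have FE: "F \<subset> E" "module.subspace sc F" unfolding subrep_def by blast+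
    have "vector_space sc" using less.prems unfolding group_rep_def by blast
    then have "vector_space.dim sc F < vector_space.dim sc E"
      using dim_strict_subspace[OF _ assms(1) less.prems(1)] FE by blast
    then show ?thesis
      using less.hyps[of F] FE less.prems(1) group_rep_subrep[OF less.prems(2) F(1)] F(1,2)
        subrep_trans[OF F(1)] by blast
  qed
qed

text \<open>The projection onto \<open>F\<close> cannot vanish on all of the subrepresentations in \<open>\<F>\<close>.\<close>

lemma irreducible_in_span_iso:
  assumes "group G" "finite (carrier G)" "group_rep G sc UNIV \<tau>"
    and F: "subrep G sc F UNIV \<tau>" "irreducible_rep G sc F \<tau>" "F \<subseteq> module.span sc (\<Union>\<F>)"
    and \<F>: "\<And>F'. F' \<in> \<F> \<Longrightarrow> irreducible_rep G sc F' \<tau>"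
  shows "\<exists>F'\<in>\<F>. iso_rep G sc F' \<tau> sc F \<tau>"
proof -
  interpret s: vector_space sc using assms(3) unfolding group_rep_def by blast
  obtain \<pi> where \<pi>: "linear_between sc UNIV sc F \<pi>" "\<forall>x\<in>F. \<pi> x = x"
    "\<forall>g\<in>carrier G. \<forall>x. \<pi> (\<tau> g x) = \<tau> g (\<pi> x)"
    using maschke_projection[OF assms(1-3) F(1)] by blast
  have grF: "group_rep G sc F \<tau>" using F(2) unfolding irreducible_rep_def by blast
  have subF: "s.subspace F" using F(1) unfolding subrep_def by blast
  have "\<exists>F'\<in>\<F>. \<exists>x\<in>F'. \<pi> x \<noteq> 0"
  proof (rule ccontr)
    assume *: "\<not> (\<exists>F'\<in>\<F>. \<exists>x\<in>F'. \<pi> x \<noteq> 0)"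
    \<comment> \<open>If the kernel contained every member of the family it would contain their
      span, hence \<open>F\<close>, on which \<open>\<pi>\<close> is the identity.\<close>
    have "s.subspace {x \<in> UNIV. \<pi> x = 0}"
      by (rule linear_between_kernel_subspace[OF \<pi>(1)]) (auto simp: s.vector_space_axioms)
    then have "s.span (\<Union>\<F>) \<subseteq> {x. \<pi> x = 0}" using * by (intro s.span_minimal) auto
    then have "F \<subseteq> {0}" using F(3) \<pi>(2) by fastforce
    then show False using F(2) s.subspace_0[OF subF] unfolding irreducible_rep_def by blast
  qed
  then obtain F' x where F': "F' \<in> \<F>" "x \<in> F'" "\<pi> x \<noteq> 0" by blast
  have lin: "linear_between sc F' sc F \<pi>"
    by (rule linear_between_mono[OF \<pi>(1)]) (use linear_between_in[OF \<pi>(1)] in auto)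
  have equi: "\<pi> (\<tau> g y) = \<tau> g (\<pi> y)" if "g \<in> carrier G" for g y using \<pi>(3) that by blast
  note emb = irreducible_rep_embedding[OF assms(1) \<F>[OF F'(1)] grF lin equi F'(2,3)]
  have "\<pi> ` F' \<noteq> {0}" using F'(2,3) by blast
  then have "\<pi> ` F' = F" using emb(2) F(2) unfolding irreducible_rep_def by blast
  then show ?thesis using emb(3) F'(1) by auto
qed

section \<open>A criterion for internal direct sums\<close>

text \<open>If two families have the same sum, then their difference at \<open>i\<close> is minus
  the sum of the other differences, so it lies both in \<open>C i\<close> and in the span of the
  rest.\<close>

lemma internal_direct_sumI:
  assumes vs: "vector_space sc" and sub: "\<And>i. i \<in> I \<Longrightarrow> module.subspace sc (C i)"
    and N: "N = module.span sc (\<Union>i\<in>I. C i)"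
    and indep: "\<And>i x. i \<in> I \<Longrightarrow> x \<in> C i \<Longrightarrow> x \<in> module.span sc (\<Union>j\<in>I - {i}. C j) \<Longrightarrow> x = 0"
  shows "internal_direct_sum sc I C N"
proof -
  interpret s: vector_space sc by fact
  define \<F> where "\<F> = {f. (\<forall>i\<in>I. f i \<in> C i) \<and> (\<forall>i. i \<notin> I \<longrightarrow> f i = 0) \<and> finite {i. f i \<noteq> 0}}"
  define S where "S f = (\<Sum>i | f i \<noteq> 0. f i)" for f :: "'b \<Rightarrow> 'a"
  \<comment> \<open>The index set of \<open>S\<close> varies with the family; enlarging it to a
    fixed finite set allows two families to be added or subtracted termwise.\<close>
  have S_eq: "S f = (\<Sum>i\<in>T. f i)" if "finite T" "{i. f i \<noteq> 0} \<subseteq> T" for f T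
    unfolding S_def by (rule sum.mono_neutral_left) (use that in auto)
  have \<F>D: "f i \<in> C i" "finite {i. f i \<noteq> 0}" "f j \<noteq> 0 \<Longrightarrow> j \<in> I" if "f \<in> \<F>" "i \<in> I" for f i j
    using that unfolding \<F>_def by auto
  have "inj_on S \<F>"
  proof (rule inj_onI)
    fix f h assume fh: "f \<in> \<F>" "h \<in> \<F>" "S f = S h"
    define T where "T = {i. f i \<noteq> 0} \<union> {i. h i \<noteq> 0}"
    have T: "finite T" "T \<subseteq> I" using fh(1,2) unfolding \<F>_def T_def by auto
    have "S f = (\<Sum>i\<in>T. f i)" by (rule S_eq[OF T(1)]) (auto simp: T_def)
    moreover have "S h = (\<Sum>i\<in>T. h i)" by (rule S_eq[OF T(1)]) (auto simp: T_def)
    ultimately have sum0: "(\<Sum>i\<in>T. f i - h i) = 0" using fh(3) by (simp add: sum_subtractf)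
    show "f = h"
    proof
      fix i
      show "f i = h i"
      proof (cases "i \<in> T")
        case True
        then have i: "i \<in> I" using T(2) by blast
        have diff: "f j - h j \<in> C j" if "j \<in> I" for j
          using fh(1,2) that sub unfolding \<F>_def by (auto intro!: s.subspace_diff)
        have "f i - h i = - (\<Sum>j\<in>T - {i}. f j - h j)"
          using sum0 sum.remove[OF T(1) True, of "\<lambda>j. f j - h j"] by (simp add: eq_neg_iff_add_eq_0)
        also have "\<dots> \<in> s.span (\<Union>j\<in>I - {i}. C j)"
          using diff T(2) by (intro s.span_neg s.span_sum s.span_base) blast
        finally have "f i - h i = 0" using indep[OF i diff[OF i]] by blast
        then show ?thesis by simp
      qed (simp add: T_def)
    qed
  qed
  moreover have "S ` \<F> = N"
  proof
    show "S ` \<F> \<subseteq> N"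
    proof
      fix x assume "x \<in> S ` \<F>"
      then obtain f where f: "f \<in> \<F>" "x = S f" by blast
      have "f i \<in> (\<Union>i\<in>I. C i)" if "f i \<noteq> 0" for i using f(1) that unfolding \<F>_def by blast
      then show "x \<in> N" unfolding f(2) S_def N by (intro s.span_sum s.span_base) blast
    qed
    \<comment> \<open>The attained sums form a subspace that contains every \<open>C i\<close>,
      hence the whole span; this gives surjectivity.\<close>
    have "s.subspace (S ` \<F>)"
    proof (rule s.subspaceI)
      have "(\<lambda>i. 0) \<in> \<F>" using sub unfolding \<F>_def by (auto simp: s.subspace_0)
      moreover have "S (\<lambda>i. 0) = 0" unfolding S_def by simp
      ultimately show "0 \<in> S ` \<F>" by (metis imageI)
    next
      fix x y assume "x \<in> S ` \<F>" "y \<in> S ` \<F>"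
      then obtain f h where fh: "f \<in> \<F>" "h \<in> \<F>" "x = S f" "y = S h" by blast
      define T where "T = {i. f i \<noteq> 0} \<union> {i. h i \<noteq> 0}"
      have T: "finite T" using fh(1,2) unfolding \<F>_def T_def by auto
      have supp: "{i. f i + h i \<noteq> 0} \<subseteq> T" unfolding T_def by auto
      have "finite {i. f i + h i \<noteq> 0}" using supp T by (rule finite_subset)
      then have "(\<lambda>i. f i + h i) \<in> \<F>"
        using fh(1,2) sub unfolding \<F>_def by (auto intro: s.subspace_add)
      moreover have "S (\<lambda>i. f i + h i) = x + y"
        unfolding fh(3,4) S_eq[of T "\<lambda>i. f i + h i", OF T supp] sum.distrib
        by (subst (1 2) S_eq[OF T]) (auto simp: T_def)
      ultimately show "x + y \<in> S ` \<F>" by (metis imageI)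
    next
      fix c x assume "x \<in> S ` \<F>"
      then obtain f where f: "f \<in> \<F>" "x = S f" by blast
      have fin: "finite {i. f i \<noteq> 0}" using f(1) unfolding \<F>_def by blast
      have supp: "{i. sc c (f i) \<noteq> 0} \<subseteq> {i. f i \<noteq> 0}" by auto
      have "finite {i. sc c (f i) \<noteq> 0}" using supp fin by (rule finite_subset)
      then have "(\<lambda>i. sc c (f i)) \<in> \<F>"
        using f(1) sub unfolding \<F>_def by (auto intro: s.subspace_scale)
      moreover have "S (\<lambda>i. sc c (f i)) = sc c x"
        unfolding f(2) S_eq[of _ "\<lambda>i. sc c (f i)", OF fin supp] s.scale_sum_right[symmetric] S_def ..
      ultimately show "sc c x \<in> S ` \<F>" by (metis imageI)
    qed
    moreover have "C i \<subseteq> S ` \<F>" if i: "i \<in> I" for i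
    proof
      fix x assume x: "x \<in> C i"
      let ?f = "\<lambda>j. if j = i then x else 0"
      have supp: "{j. ?f j \<noteq> 0} \<subseteq> {i}" by auto
      have "finite {j. ?f j \<noteq> 0}" by (rule finite_subset[OF supp]) simp
      then have "?f \<in> \<F>" using i x sub unfolding \<F>_def by (auto intro: s.subspace_0)
      moreover have "S ?f = x" using S_eq[of "{i}" ?f, OF _ supp] by simp
      ultimately show "x \<in> S ` \<F>" by (metis imageI)
    qed
    ultimately show "N \<subseteq> S ` \<F>" unfolding N by (intro s.span_minimal) auto
  qed
  ultimately have "bij_betw S \<F> N" unfolding bij_betw_def by blast
  then show ?thesis
    unfolding internal_direct_sum_def \<F>_def S_def using sub by blast
qed

lemma span_subrep:
  assumes "group_rep G sc UNIV \<tau>" "\<And>F. F \<in> \<F> \<Longrightarrow> subrep G sc F UNIV \<tau>"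
  shows "subrep G sc (module.span sc (\<Union>\<F>)) UNIV \<tau>"
proof -
  interpret s: vector_space sc using assms(1) unfolding group_rep_def by blast
  have "\<tau> g ` s.span (\<Union>\<F>) \<subseteq> s.span (\<Union>\<F>)" if g: "g \<in> carrier G" for g
  proof -
    note lin = group_rep_linear[OF assms(1) g]
    have "s.subspace {x. \<tau> g x \<in> s.span (\<Union>\<F>)}"
      using linear_between_zero[OF lin s.vector_space_axioms] linear_between_add[OF lin]
        linear_between_scale[OF lin]
      by (intro s.subspaceI) (auto intro: s.span_zero s.span_add s.span_scale)
    moreover have "\<tau> g x \<in> s.span (\<Union>\<F>)" if "F \<in> \<F>" "x \<in> F" for F x
      using assms(2)[OF that(1)] that g unfolding subrep_def by (intro s.span_base) blast
    ultimately have "s.span (\<Union>\<F>) \<subseteq> {x. \<tau> g x \<in> s.span (\<Union>\<F>)}"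
      by (intro s.span_minimal) auto
    then show ?thesis by blast
  qed
  then show ?thesis unfolding subrep_def by simp
qed

section \<open>Polynomial functions in coordinates\<close>

interpretation fs: vector_space fun_scale
  by (rule vector_space_fun_scale)

lemma fun_scale_apply: "fun_scale c f x = c * f x"
  by (simp add: fun_scale_def)

text \<open>As simp rules these would also rewrite the eta-expanded functions that induction rules produce.\<close>

declare plus_fun_apply [simp del] zero_fun_apply [simp del] times_fun_apply [simp del]
  one_fun_apply [simp del]

lemmas fun_apply = plus_fun_apply zero_fun_apply times_fun_apply one_fun_apply fun_scale_apply

lemma fun_scale_mult_left: "fun_scale c P * Q = fun_scale c (P * Q)"
  by (simp add: fun_eq_iff fun_apply)

lemma fun_scale_mult_right: "P * fun_scale c Q = fun_scale c (P * Q)"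
  by (simp add: fun_eq_iff fun_apply)

lemma sum_fun_apply: "(\<Sum>i\<in>I. f i) x = (\<Sum>i\<in>I. f i x :: 'b :: comm_monoid_add)"
  by (induction I rule: infinite_finite_induct) (simp_all add: fun_apply)

lemma linear_between_funpow:
  assumes "linear_between fun_scale E fun_scale E f"
  shows "linear_between fun_scale E fun_scale E (f ^^ k)"
proof (induction k)
  case 0
  show ?case by (simp add: linear_between_def)
next
  case (Suc k)
  show ?case using linear_between_compose[OF Suc assms] by (simp add: comp_def)
qed

locale based_space = V: finite_dimensional_vector_space sc "set bs"
  for sc :: "complex \<Rightarrow> 'v::ab_group_add \<Rightarrow> 'v" and bs :: "'v list" +
  assumes distinct_basis: "distinct bs"
begin

abbreviation n where "n \<equiv> length bs"
abbreviation crd where "crd \<equiv> coordinate sc bs"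
abbreviation M where "M \<equiv> mono_fun sc bs"
abbreviation A where "A \<equiv> poly_funs sc bs"
abbreviation H where "H \<equiv> homog_funs sc bs"
abbreviation pd where "pd \<equiv> partial_derivs sc bs"
abbreviation tdeg where "tdeg \<alpha> \<equiv> (\<Sum>i<n. \<alpha> i)" for \<alpha> :: "nat \<Rightarrow> nat"
abbreviation MI where "MI \<equiv> multi_indices n"
abbreviation I where "I m \<equiv> {\<alpha> \<in> MI. tdeg \<alpha> = m}"

section \<open>Coordinates, monomials and induction over polynomials\<close>

lemma in_span_basis: "v \<in> V.span (set bs)"
  by (simp add: V.span_Basis)

lemma crd_add: "crd i (u + v) = crd i u + crd i v"
  unfolding coordinate_def by (simp add: V.representation_add V.independent_Basis in_span_basis)

lemma crd_scale: "crd i (sc c v) = c * crd i v"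
  unfolding coordinate_def by (simp add: V.representation_scale V.independent_Basis in_span_basis)

lemma crd_basis: "i < n \<Longrightarrow> j < n \<Longrightarrow> crd i (bs ! j) = (if i = j then 1 else 0)"
  unfolding coordinate_def using distinct_basis
  by (simp add: V.representation_basis V.independent_Basis nth_eq_iff_index_eq)

lemma crd_shift:
  "i < n \<Longrightarrow> j < n \<Longrightarrow> crd i (v + sc t (bs ! j)) = crd i v + (if i = j then t else 0)"
  by (simp add: crd_add crd_scale crd_basis)

lemma crd_zero: "crd i 0 = 0"
  using crd_add[of i 0 0] by simp

lemma coordinate_expansion: "(\<Sum>i<n. sc (crd i v) (bs ! i)) = v"
proof -
  have "(\<Sum>b\<in>set bs. sc (V.representation (set bs) v b) b) = v"
    by (rule V.sum_representation_eq) (auto simp: V.independent_Basis V.span_Basis)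
  moreover have "(\<Sum>b\<in>set bs. sc (V.representation (set bs) v b) b)
    = (\<Sum>i<n. sc (V.representation (set bs) v (bs ! i)) (bs ! i))"
    by (rule sum.reindex_bij_betw[symmetric, OF bij_betw_nth]) (auto simp: distinct_basis)
  ultimately show ?thesis by (simp add: coordinate_def)
qed

lemma mono_fun_cong: "(\<And>i. i < n \<Longrightarrow> \<alpha> i = \<beta> i) \<Longrightarrow> M \<alpha> = M \<beta>"
  unfolding mono_fun_def by (auto simp: fun_eq_iff)

lemma mono_fun_zero: "M \<alpha> 0 = (if \<forall>i<n. \<alpha> i = 0 then 1 else 0)"
  unfolding mono_fun_def by (auto simp: crd_zero)

lemma mono_fun_times: "M \<alpha> * M \<beta> = M (\<lambda>i. \<alpha> i + \<beta> i)"
  unfolding mono_fun_def by (auto simp: fun_eq_iff fun_apply power_add prod.distrib)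

lemma mono_fun_in_poly: "\<alpha> \<in> MI \<Longrightarrow> M \<alpha> \<in> A"
  unfolding poly_funs_def by (rule fs.span_base) blast

lemma mono_fun_in_homog: "\<alpha> \<in> MI \<Longrightarrow> tdeg \<alpha> = m \<Longrightarrow> M \<alpha> \<in> H m"
  unfolding homog_funs_def by (rule fs.span_base) blast

lemma poly_subspace: "fs.subspace A" unfolding poly_funs_def by (rule fs.subspace_span)
lemma homog_subspace: "fs.subspace (H m)" unfolding homog_funs_def by (rule fs.subspace_span)

lemma homog_subset_poly: "H m \<subseteq> A"
  unfolding homog_funs_def poly_funs_def by (rule fs.span_mono) blast

lemma finite_multi_indices_of_degree: "finite (I m)"
proof -
  have "I m \<subseteq> {f. \<forall>i. (i \<in> {..<n} \<longrightarrow> f i \<in> {..m}) \<and> (i \<notin> {..<n} \<longrightarrow> f i = 0)}"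
    unfolding multi_indices_def using member_le_sum[of _ "{..<n}"] by auto
  then show ?thesis by (rule finite_subset) (intro finite_set_of_finite_funs; simp)
qed

lemma homog_funs_finite_span:
  obtains T where "finite T" "H m = fs.span T"
  using that[of "M ` I m"] finite_multi_indices_of_degree unfolding homog_funs_def by blast

text \<open>The polynomials with property \<open>Q\<close> form a subspace containing the monomials.
  Claims that respect linear combinations are thereby reduced to monomials.\<close>

lemma poly_induct [consumes 1, case_names mono zero add scale]:
  assumes "P \<in> A"
    and "\<And>\<alpha>. \<alpha> \<in> MI \<Longrightarrow> Q (M \<alpha>)" "Q 0"
    and "\<And>P P'. P \<in> A \<Longrightarrow> P' \<in> A \<Longrightarrow> Q P \<Longrightarrow> Q P' \<Longrightarrow> Q (P + P')"
    and "\<And>c P. P \<in> A \<Longrightarrow> Q P \<Longrightarrow> Q (fun_scale c P)"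
  shows "Q P"
proof -
  have "fs.subspace {P \<in> A. Q P}"
    using assms(3-) poly_subspace
    by (intro fs.subspaceI) (auto simp: fs.subspace_0 fs.subspace_add fs.subspace_scale)
  moreover have "M ` MI \<subseteq> {P \<in> A. Q P}" using assms(2) mono_fun_in_poly by auto
  ultimately have "fs.span (M ` MI) \<subseteq> {P \<in> A. Q P}" by (rule fs.span_minimal[rotated])
  then show ?thesis using assms(1) unfolding poly_funs_def by blast
qed

lemma homog_induct [consumes 1, case_names mono zero add scale]:
  assumes "P \<in> H m"
    and "\<And>\<alpha>. \<alpha> \<in> MI \<Longrightarrow> tdeg \<alpha> = m \<Longrightarrow> Q (M \<alpha>)" "Q 0"
    and "\<And>P P'. P \<in> H m \<Longrightarrow> P' \<in> H m \<Longrightarrow> Q P \<Longrightarrow> Q P' \<Longrightarrow> Q (P + P')"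
    and "\<And>c P. P \<in> H m \<Longrightarrow> Q P \<Longrightarrow> Q (fun_scale c P)"
  shows "Q P"
proof -
  have "fs.subspace {P \<in> H m. Q P}"
    using assms(3-) homog_subspace
    by (intro fs.subspaceI) (auto simp: fs.subspace_0 fs.subspace_add fs.subspace_scale)
  moreover have "M ` I m \<subseteq> {P \<in> H m. Q P}" using assms(2) mono_fun_in_homog by auto
  ultimately have "fs.span (M ` I m) \<subseteq> {P \<in> H m. Q P}" by (rule fs.span_minimal[rotated])
  then show ?thesis using assms(1) unfolding homog_funs_def by blast
qed

lemma multi_indices_fun_upd: "\<alpha> \<in> MI \<Longrightarrow> j < n \<Longrightarrow> \<alpha>(j := a) \<in> MI"
  unfolding multi_indices_def by auto

lemma multi_indices_add: "\<alpha> \<in> MI \<Longrightarrow> \<beta> \<in> MI \<Longrightarrow> (\<lambda>i. \<alpha> i + \<beta> i) \<in> MI"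
  unfolding multi_indices_def by auto

lemma multi_indices_eqI:
  assumes "\<alpha> \<in> MI" "\<beta> \<in> MI" "\<And>i. i < n \<Longrightarrow> \<alpha> i = \<beta> i"
  shows "\<alpha> = \<beta>"
proof
  fix i show "\<alpha> i = \<beta> i"
    using assms unfolding multi_indices_def by (cases "i < n") auto
qed

section \<open>Partial derivatives of monomials\<close>

text \<open>Only the factor of coordinate \<open>j\<close> depends on \<open>t\<close>. For
  \<open>\<alpha> j = 0\<close> the truncated exponent \<open>\<alpha> j - 1\<close> is harmless
  because the leading factor vanishes.\<close>

lemma mono_fun_derivative:
  assumes "j < n"
  shows "((\<lambda>t. M \<alpha> (v + sc t (bs ! j))) has_field_derivative
    of_nat (\<alpha> j) * M (\<alpha>(j := \<alpha> j - 1)) v) (at 0)"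
proof -
  let ?C = "\<Prod>i\<in>{..<n} - {j}. crd i v ^ \<alpha> i"
  have "M \<alpha> (v + sc t (bs ! j)) = (crd j v + t) ^ \<alpha> j * ?C" for t
    unfolding mono_fun_def using assms
    by (subst prod.remove[of _ j]) (auto simp: crd_shift intro!: prod.cong)
  moreover have "M (\<alpha>(j := \<alpha> j - 1)) v = crd j v ^ (\<alpha> j - 1) * ?C"
    unfolding mono_fun_def using assms
    by (subst prod.remove[of _ j]) (auto intro!: prod.cong)
  moreover have "((\<lambda>t. (crd j v + t) ^ \<alpha> j * ?C) has_field_derivative
      of_nat (\<alpha> j) * (crd j v ^ (\<alpha> j - 1) * ?C)) (at 0)"
    by (auto intro!: derivative_eq_intros)
  ultimately show ?thesis by simp
qed

lemma partial_deriv_mono_fun: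
  "j < n \<Longrightarrow> partial_deriv sc bs j (M \<alpha>) = fun_scale (of_nat (\<alpha> j)) (M (\<alpha>(j := \<alpha> j - 1)))"
  unfolding partial_deriv_def using DERIV_imp_deriv[OF mono_fun_derivative] by (auto simp: fun_eq_iff fun_apply)

text \<open>\<open>deriv\<close> is a total operator, and its additivity is available only for
  differentiable functions; this supplies that condition for
  \<open>partial_deriv_linear\<close>.\<close>

lemma poly_differentiable:
  assumes "P \<in> A" "j < n"
  shows "(\<lambda>t. P (v + sc t (bs ! j))) field_differentiable (at 0)"
  using assms(1)
proof (induction rule: poly_induct)
  case (mono \<alpha>)
  show ?case using mono_fun_derivative[OF assms(2)] unfolding field_differentiable_def by blast
next
  case (add P P')
  then show ?case by (auto simp: fun_apply intro!: derivative_intros)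
next
  case (scale c P)
  then show ?case by (auto simp: fun_apply intro!: derivative_intros)
qed (simp add: fun_apply)

lemma partial_deriv_linear:
  assumes "j < n"
  shows "linear_between fun_scale A fun_scale A (partial_deriv sc bs j)"
proof -
  have add: "partial_deriv sc bs j (P + P') = partial_deriv sc bs j P + partial_deriv sc bs j P'"
    if "P \<in> A" "P' \<in> A" for P P'
    unfolding partial_deriv_def plus_fun_apply fun_eq_iff
    using poly_differentiable[OF _ assms] that by auto
  have scale: "partial_deriv sc bs j (fun_scale c P) = fun_scale c (partial_deriv sc bs j P)"
    if "P \<in> A" for c P
    unfolding partial_deriv_def fun_scale_apply fun_eq_iff
    using poly_differentiable[OF _ assms] that by auto
  have "partial_deriv sc bs j P \<in> A" if "P \<in> A" for P
    using that
  proof (induction rule: poly_induct)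
    case (mono \<alpha>)
    then show ?case
      using partial_deriv_mono_fun assms multi_indices_fun_upd mono_fun_in_poly poly_subspace
      by (simp add: fs.subspace_scale)
  next
    case zero
    have "partial_deriv sc bs j 0 = 0" unfolding partial_deriv_def by (simp add: fun_eq_iff fun_apply)
    then have "partial_deriv sc bs j 0 \<in> A" using fs.subspace_0[OF poly_subspace] by simp
    then show ?case .
  qed (use poly_subspace in \<open>auto simp: add scale fs.subspace_add fs.subspace_scale\<close>)
  then show ?thesis unfolding linear_between_def using add scale by blast
qed

text \<open>\<^term>\<open>\<Prod>i<k. a - i\<close> is the falling factorial; with truncated subtraction it vanishes
  exactly when \<open>a < k\<close>.\<close>

abbreviation ffact :: "nat \<Rightarrow> nat \<Rightarrow> nat" where "ffact a k \<equiv> \<Prod>i<k. a - i"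

lemma partial_deriv_power_mono_fun:
  assumes "j < n" "\<alpha> \<in> MI"
  shows "(partial_deriv sc bs j ^^ k) (M \<alpha>) = fun_scale (of_nat (ffact (\<alpha> j) k)) (M (\<alpha>(j := \<alpha> j - k)))"
proof -
  define \<alpha>' where "\<alpha>' k = \<alpha>(j := \<alpha> j - k)" for k
  have \<alpha>': "M (\<alpha>' k) \<in> A" for k
    unfolding \<alpha>'_def using assms by (intro mono_fun_in_poly multi_indices_fun_upd)
  have deriv: "partial_deriv sc bs j (M (\<alpha>' k)) = fun_scale (of_nat (\<alpha> j - k)) (M (\<alpha>' (Suc k)))" for k
    unfolding \<alpha>'_def using partial_deriv_mono_fun[OF assms(1), of "\<alpha>(j := \<alpha> j - k)"] by simp
  have "(partial_deriv sc bs j ^^ k) (M \<alpha>) = fun_scale (of_nat (ffact (\<alpha> j) k)) (M (\<alpha>' k))"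
  proof (induction k)
    case 0
    show ?case by (simp add: \<alpha>'_def)
  next
    case (Suc k)
    then show ?case
      by (simp add: linear_between_scale[OF partial_deriv_linear[OF assms(1)] \<alpha>'] deriv)
  qed
  then show ?thesis unfolding \<alpha>'_def .
qed

lemma partial_derivs_linear: "linear_between fun_scale A fun_scale A (pd \<beta>)"
proof -
  have "linear_between fun_scale A fun_scale A (foldr (\<lambda>i D. (partial_deriv sc bs i ^^ \<beta> i) \<circ> D) xs id)"
    if "set xs \<subseteq> {..<n}" for xs
    using that
  proof (induction xs)
    case Nil
    show ?case by (simp add: linear_between_def)
  next
    case (Cons j xs)
    then have "j < n" "set xs \<subseteq> {..<n}" by auto
    note linear_between_compose[OF Cons.IH[OF this(2)]
      linear_between_funpow[OF partial_deriv_linear[OF this(1)]], folded comp_def]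
    moreover have "foldr (\<lambda>i D. (partial_deriv sc bs i ^^ \<beta> i) \<circ> D) (j # xs) id =
        (partial_deriv sc bs j ^^ \<beta> j) \<circ> foldr (\<lambda>i D. (partial_deriv sc bs i ^^ \<beta> i) \<circ> D) xs id"
      by simp
    ultimately show ?case by (simp only:)
  qed
  from this[of "[0..<n]"] show ?thesis
    unfolding partial_derivs_def by (simp add: atLeast0LessThan)
qed

lemma partial_derivs_mono_fun:
  assumes "\<alpha> \<in> MI"
  shows "pd \<beta> (M \<alpha>) = fun_scale (of_nat (\<Prod>i<n. ffact (\<alpha> i) (\<beta> i))) (M (\<lambda>i. \<alpha> i - \<beta> i))"
proof -
  \<comment> \<open>Generalized to lists \<open>xs\<close> for the induction: exactly the
    coordinates listed have been differentiated, each once because \<open>xs\<close> is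
    distinct.\<close>
  have "foldr (\<lambda>i D. (partial_deriv sc bs i ^^ \<beta> i) \<circ> D) xs id (M \<alpha>) =
      fun_scale (of_nat (\<Prod>i\<in>set xs. ffact (\<alpha> i) (\<beta> i)))
        (M (\<lambda>i. if i \<in> set xs then \<alpha> i - \<beta> i else \<alpha> i))"
    if "set xs \<subseteq> {..<n}" "distinct xs" for xs
    using that
  proof (induction xs)
    case Nil
    show ?case by simp
  next
    case (Cons j xs)
    let ?\<alpha> = "\<lambda>i. if i \<in> set xs then \<alpha> i - \<beta> i else \<alpha> i"
    have j: "j < n" "?\<alpha> \<in> MI" "?\<alpha> j = \<alpha> j"
      using Cons.prems assms by (auto simp: multi_indices_def)
    have "(partial_deriv sc bs j ^^ \<beta> j) (fun_scale (of_nat (\<Prod>i\<in>set xs. ffact (\<alpha> i) (\<beta> i))) (M ?\<alpha>)) =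
      fun_scale (of_nat (\<Prod>i\<in>set xs. ffact (\<alpha> i) (\<beta> i))) ((partial_deriv sc bs j ^^ \<beta> j) (M ?\<alpha>))"
      using linear_between_scale[OF linear_between_funpow[OF partial_deriv_linear[OF j(1)]]]
        mono_fun_in_poly[OF j(2)] by blast
    also have "(partial_deriv sc bs j ^^ \<beta> j) (M ?\<alpha>) =
      fun_scale (of_nat (ffact (\<alpha> j) (\<beta> j))) (M (?\<alpha>(j := \<alpha> j - \<beta> j)))"
      using partial_deriv_power_mono_fun[OF j(1,2)] j(3) by simp
    also have "M (?\<alpha>(j := \<alpha> j - \<beta> j)) = M (\<lambda>i. if i \<in> set (j # xs) then \<alpha> i - \<beta> i else \<alpha> i)"
      by (rule mono_fun_cong) auto
    finally show ?case using Cons by (simp add: mult.commute)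
  qed
  from this[of "[0..<n]"] show ?thesis
    unfolding partial_derivs_def using mono_fun_cong[of "\<lambda>i. if i < n then \<alpha> i - \<beta> i else \<alpha> i" "\<lambda>i. \<alpha> i - \<beta> i"]
    by (simp add: atLeast0LessThan)
qed

lemma ffact_eq_0: "a < k \<Longrightarrow> ffact a k = 0"
  by (auto simp: prod_zero_iff)

lemma ffact_self: "ffact a a = fact a"
  by (simp add: fact_prod_rev atLeast0LessThan)

section \<open>Taylor coefficients and the grading\<close>

text \<open>The Taylor coefficient at the origin. Polynomials are functions here, so their
  coefficients have to be recovered from derivatives.\<close>

definition coeff_of :: "(nat \<Rightarrow> nat) \<Rightarrow> ('v \<Rightarrow> complex) \<Rightarrow> complex" where
  "coeff_of \<beta> P = pd \<beta> P 0 / of_nat (\<Prod>i<n. fact (\<beta> i))"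

lemma prod_fact_nonzero: "(of_nat (\<Prod>i<n. fact (\<beta> i)) :: complex) \<noteq> 0"
  by (simp add: prod_zero_iff)

text \<open>If the exponents differ at \<open>i\<close>, then either coordinate \<open>i\<close> is
  differentiated too often, or a positive power of it remains and vanishes at the origin. This makes
  the monomials linearly independent.\<close>

lemma coeff_of_mono_fun:
  assumes "\<alpha> \<in> MI" "\<beta> \<in> MI"
  shows "coeff_of \<beta> (M \<alpha>) = (if \<alpha> = \<beta> then 1 else 0)"
proof (cases "\<alpha> = \<beta>")
  case True
  then show ?thesis
    using prod_fact_nonzero[of \<beta>] unfolding coeff_of_def
    by (simp add: partial_derivs_mono_fun[OF assms(2)] ffact_self mono_fun_zero fun_apply)
next
  case False
  then obtain i where i: "i < n" "\<alpha> i \<noteq> \<beta> i"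
    using multi_indices_eqI[OF assms] by blast
  have "of_nat (\<Prod>i<n. ffact (\<alpha> i) (\<beta> i)) * M (\<lambda>i. \<alpha> i - \<beta> i) 0 = 0"
  proof (cases "\<alpha> i < \<beta> i")
    case True
    then have "\<exists>i\<in>{..<n}. ffact (\<alpha> i) (\<beta> i) = 0" using i(1) ffact_eq_0 by blast
    then have "(\<Prod>i<n. ffact (\<alpha> i) (\<beta> i)) = 0" by (rule prod_zero[OF finite_lessThan])
    then show ?thesis by simp
  next
    case False
    then have "\<alpha> i - \<beta> i \<noteq> 0" using i(2) by simp
    then have "\<not> (\<forall>i<n. \<alpha> i - \<beta> i = 0)" using spec[of _ i] i(1) by meson
    then have "M (\<lambda>i. \<alpha> i - \<beta> i) 0 = 0" unfolding mono_fun_zero by (rule if_not_P)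
    then show ?thesis by (simp only: mult_zero_right)
  qed
  then show ?thesis
    using False unfolding coeff_of_def by (simp add: partial_derivs_mono_fun[OF assms(1)] fun_scale_apply)
qed

lemma coeff_of_add: "P \<in> A \<Longrightarrow> P' \<in> A \<Longrightarrow> coeff_of \<beta> (P + P') = coeff_of \<beta> P + coeff_of \<beta> P'"
  unfolding coeff_of_def using linear_between_add[OF partial_derivs_linear]
  by (simp add: fun_apply add_divide_distrib)

lemma coeff_of_scale: "P \<in> A \<Longrightarrow> coeff_of \<beta> (fun_scale c P) = c * coeff_of \<beta> P"
  unfolding coeff_of_def using linear_between_scale[OF partial_derivs_linear] by (simp add: fun_apply)

lemma coeff_of_zero: "coeff_of \<beta> 0 = 0"
  using coeff_of_scale[of 0 \<beta> 0] fs.subspace_0[OF poly_subspace] by simp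

lemma coeff_of_sum:
  assumes "\<And>i. i \<in> S \<Longrightarrow> f i \<in> A"
  shows "coeff_of \<beta> (\<Sum>i\<in>S. f i) = (\<Sum>i\<in>S. coeff_of \<beta> (f i))"
  using assms
proof (induction S rule: infinite_finite_induct)
  case (insert i S)
  have "(\<Sum>i\<in>S. f i) \<in> A" by (rule fs.subspace_sum[OF poly_subspace]) (use insert in auto)
  then show ?case using insert by (simp add: coeff_of_add)
qed (simp_all add: coeff_of_zero)

definition homog_part :: "nat \<Rightarrow> ('v \<Rightarrow> complex) \<Rightarrow> 'v \<Rightarrow> complex" where
  "homog_part m P = (\<Sum>\<alpha>\<in>I m. fun_scale (coeff_of \<alpha> P) (M \<alpha>))"

lemma homog_part_linear: "linear_between fun_scale A fun_scale (H m) (homog_part m)"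
proof -
  have "homog_part m P \<in> H m" for P
    unfolding homog_part_def using homog_subspace mono_fun_in_homog
    by (intro fs.subspace_sum fs.subspace_scale) auto
  then show ?thesis
    unfolding linear_between_def homog_part_def
    by (auto simp: coeff_of_add coeff_of_scale fs.scale_left_distrib sum.distrib fs.scale_sum_right)
qed

lemma homog_part_mono_fun: "\<alpha> \<in> MI \<Longrightarrow> homog_part m (M \<alpha>) = (if tdeg \<alpha> = m then M \<alpha> else 0)"
proof -
  assume a: "\<alpha> \<in> MI"
  have "homog_part m (M \<alpha>) = (\<Sum>\<beta>\<in>I m. if \<beta> = \<alpha> then M \<alpha> else 0)"
    unfolding homog_part_def by (rule sum.cong) (auto simp: coeff_of_mono_fun[OF a])
  then show ?thesis using a finite_multi_indices_of_degree by (simp add: sum.delta)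
qed

lemma homog_part_zero: "homog_part m 0 = 0"
  using linear_between_zero[OF homog_part_linear vector_space_fun_scale poly_subspace] .

lemma homog_part_in: "P \<in> A \<Longrightarrow> homog_part m P \<in> H m"
  using linear_between_in[OF homog_part_linear] .

lemma homog_part_homog:
  assumes "P \<in> H k"
  shows "homog_part m P = (if m = k then P else 0)"
  using assms
proof (induction rule: homog_induct)
  case (mono \<alpha>)
  then show ?case by (auto simp: homog_part_mono_fun)
next
  case zero
  show ?case by (simp add: homog_part_zero)
next
  case (add P P')
  then have "P \<in> A" "P' \<in> A" using homog_subset_poly by blast+
  then show ?case using add linear_between_add[OF homog_part_linear] by simp
next
  case (scale c P)
  then have "P \<in> A" using homog_subset_poly by blast
  then show ?case using scale linear_between_scale[OF homog_part_linear] by simp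
qed

text \<open>Allowing every large enough \<open>N\<close> lets the additive step merge two bounds by
  taking their maximum.\<close>

lemma poly_eq_sum_homog_part:
  assumes "P \<in> A"
  shows "\<exists>N0. \<forall>N\<ge>N0. P = (\<Sum>m<N. homog_part m P)"
  using assms
proof (induction rule: poly_induct)
  case (mono \<alpha>)
  then show ?case by (intro exI[of _ "Suc (tdeg \<alpha>)"]) (auto simp: homog_part_mono_fun sum.delta')
next
  case zero
  show ?case by (simp add: homog_part_zero)
next
  case (add P P')
  then obtain N0 N0' where "\<forall>N\<ge>N0. P = (\<Sum>m<N. homog_part m P)" "\<forall>N\<ge>N0'. P' = (\<Sum>m<N. homog_part m P')" by blast
  then show ?case
    using linear_between_add[OF homog_part_linear add(1,2)]
    by (intro exI[of _ "max N0 N0'"]) (simp add: sum.distrib)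
next
  case (scale c P)
  then show ?case
    using linear_between_scale[OF homog_part_linear scale(1)] by (auto simp: fs.scale_sum_right[symmetric])
qed

lemma poly_eq_0I: "P \<in> A \<Longrightarrow> (\<And>m. homog_part m P = 0) \<Longrightarrow> P = 0"
  using poly_eq_sum_homog_part[of P] by auto

lemma homog_part_eq_0D:
  assumes "P \<in> H m" "homog_part m P = 0"
  shows "P = 0"
  using assms homog_part_homog by simp

section \<open>Products, linear substitutions and translations\<close>

lemma homog_mult:
  assumes "P \<in> H a" "Q \<in> H b"
  shows "P * Q \<in> H (a + b)"
proof -
  have base: "M \<alpha> * Q \<in> H (a + b)" if "\<alpha> \<in> MI" "tdeg \<alpha> = a" for \<alpha>
    using assms(2)
  proof (induction rule: homog_induct)
    case (mono \<beta>)
    then show ?case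
      unfolding mono_fun_times using that
      by (intro mono_fun_in_homog multi_indices_add) (auto simp: sum.distrib)
  qed (use homog_subspace in \<open>auto simp: fs.subspace_0 fs.subspace_add fs.subspace_scale
        distrib_left fun_scale_mult_right\<close>)
  show ?thesis
    using assms(1)
    by (induction rule: homog_induct)
      (use homog_subspace base in \<open>auto simp: fs.subspace_0 fs.subspace_add fs.subspace_scale
        distrib_right fun_scale_mult_left\<close>)
qed

lemma poly_mult:
  assumes "P \<in> A" "Q \<in> A"
  shows "P * Q \<in> A"
proof -
  have base: "M \<alpha> * Q \<in> A" if "\<alpha> \<in> MI" for \<alpha>
    using assms(2)
  proof (induction rule: poly_induct)
    case (mono \<beta>)
    then show ?case
      unfolding mono_fun_times using that by (intro mono_fun_in_poly multi_indices_add)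
  qed (use poly_subspace in \<open>auto simp: fs.subspace_0 fs.subspace_add fs.subspace_scale
        distrib_left fun_scale_mult_right\<close>)
  show ?thesis
    using assms(1)
    by (induction rule: poly_induct)
      (use poly_subspace base in \<open>auto simp: fs.subspace_0 fs.subspace_add fs.subspace_scale
        distrib_right fun_scale_mult_left\<close>)
qed

lemma const_in_homog: "(\<lambda>v. c) \<in> H 0"
proof -
  have "fun_scale c (M (\<lambda>i. 0)) \<in> H 0"
    by (intro fs.subspace_scale[OF homog_subspace] mono_fun_in_homog) (auto simp: multi_indices_def)
  then show ?thesis by (simp add: mono_fun_def fun_scale_def)
qed

lemma crd_in_homog: "i < n \<Longrightarrow> crd i \<in> H 1"
proof -
  assume i: "i < n"
  have "M (\<lambda>j. if j = i then 1 else 0) = crd i"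
  proof
    fix v
    have "(\<Prod>j<n. crd j v ^ (if j = i then 1 else 0)) = (\<Prod>j<n. if j = i then crd j v else 1)"
      by (intro prod.cong) auto
    then show "M (\<lambda>j. if j = i then 1 else 0) v = crd i v"
      unfolding mono_fun_def using i by (simp add: prod.delta)
  qed
  moreover have "M (\<lambda>j. if j = i then 1 else 0) \<in> H 1"
    using i by (intro mono_fun_in_homog) (auto simp: multi_indices_def)
  ultimately show ?thesis by simp
qed

text \<open>Expanding the argument in the basis writes \<open>f\<close> as a combination of
  coordinates.\<close>

lemma linear_functional_in_homog:
  assumes "\<And>u v. f (u + v) = f u + f v" "\<And>c v. f (sc c v) = c * f v"
  shows "f \<in> H 1"
proof -
  have zero: "f 0 = 0" using assms(2)[of 0 0] by simp
  have sum: "f (\<Sum>i\<in>S. g i) = (\<Sum>i\<in>S. f (g i))" for S :: "nat set" and g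
    by (induction S rule: infinite_finite_induct) (simp_all add: zero assms(1))
  have "f v = (\<Sum>i<n. fun_scale (f (bs ! i)) (crd i)) v" for v
  proof -
    have "f v = f (\<Sum>i<n. sc (crd i v) (bs ! i))" by (simp add: coordinate_expansion)
    also have "\<dots> = (\<Sum>i<n. f (bs ! i) * crd i v)" by (simp add: sum assms(2) mult.commute)
    finally show ?thesis by (simp add: sum_fun_apply fun_apply)
  qed
  then have "f = (\<Sum>i<n. fun_scale (f (bs ! i)) (crd i))" by (rule ext)
  also have "\<dots> \<in> H 1"
    by (intro fs.subspace_sum fs.subspace_scale homog_subspace crd_in_homog) auto
  finally show ?thesis .
qed

lemma homog_power: "P \<in> H 1 \<Longrightarrow> (\<lambda>v. P v ^ k) \<in> H k"
proof (induction k)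
  case 0
  show ?case using const_in_homog[of 1] by simp
next
  case (Suc k)
  then have "P * (\<lambda>v. P v ^ k) \<in> H (1 + k)" by (intro homog_mult) auto
  moreover have "P * (\<lambda>v. P v ^ k) = (\<lambda>v. P v ^ Suc k)" by (simp add: fun_eq_iff fun_apply)
  ultimately show ?case by simp
qed

lemma homog_monomial:
  fixes k :: nat
  assumes "\<And>i. i < k \<Longrightarrow> f i \<in> H 1"
  shows "(\<lambda>v. \<Prod>i<k. f i v ^ a i) \<in> H (\<Sum>i<k. a i)"
  using assms
proof (induction k)
  case 0
  show ?case using const_in_homog[of 1] by simp
next
  case (Suc k)
  then have "(\<lambda>v. \<Prod>i<k. f i v ^ a i) * (\<lambda>v. f k v ^ a k) \<in> H ((\<Sum>i<k. a i) + a k)"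
    by (intro homog_mult homog_power) auto
  moreover have "(\<lambda>v. \<Prod>i<k. f i v ^ a i) * (\<lambda>v. f k v ^ a k) = (\<lambda>v. \<Prod>i<Suc k. f i v ^ a i)"
    by (simp add: fun_eq_iff fun_apply)
  ultimately show ?case by simp
qed

lemma const_in_poly: "(\<lambda>v. c) \<in> A"
  using const_in_homog homog_subset_poly by blast

lemma poly_monomial:
  fixes k :: nat
  assumes "\<And>i. i < k \<Longrightarrow> f i \<in> A"
  shows "(\<lambda>v. \<Prod>i<k. f i v ^ a i) \<in> A"
  using assms
proof (induction k)
  case 0
  show ?case using const_in_poly[of 1] by simp
next
  case (Suc k)
  have "(\<lambda>v. f k v ^ l) \<in> A" for l
  proof (induction l)
    case 0
    show ?case using const_in_poly[of 1] by simp
  next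
    case (Suc l)
    then have "f k * (\<lambda>v. f k v ^ l) \<in> A" using Suc.prems Suc \<open>\<And>i. i < Suc k \<Longrightarrow> f i \<in> A\<close>
      by (intro poly_mult) auto
    moreover have "f k * (\<lambda>v. f k v ^ l) = (\<lambda>v. f k v ^ Suc l)" by (simp add: fun_eq_iff fun_apply)
    ultimately show ?case by simp
  qed
  then have "(\<lambda>v. \<Prod>i<k. f i v ^ a i) * (\<lambda>v. f k v ^ a k) \<in> A"
    using Suc by (intro poly_mult) auto
  moreover have "(\<lambda>v. \<Prod>i<k. f i v ^ a i) * (\<lambda>v. f k v ^ a k) = (\<lambda>v. \<Prod>i<Suc k. f i v ^ a i)"
    by (simp add: fun_eq_iff fun_apply)
  ultimately show ?case by simp
qed

text \<open>Each coordinate of \<open>L v\<close> is a linear form in \<open>v\<close>, so a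
  monomial becomes a product of as many linear forms. This is why the group preserves
  degrees.\<close>

lemma homog_compose_linear:
  assumes L: "\<And>u v. L (u + v) = L u + L v" "\<And>c v. L (sc c v) = sc c (L v)"
    and "P \<in> H m"
  shows "(\<lambda>v. P (L v)) \<in> H m"
  using assms(3)
proof (induction rule: homog_induct)
  case (mono \<alpha>)
  have "(\<lambda>v. crd i (L v)) \<in> H 1" for i
    by (rule linear_functional_in_homog) (simp_all add: L crd_add crd_scale)
  then have "(\<lambda>v. \<Prod>i<n. crd i (L v) ^ \<alpha> i) \<in> H (tdeg \<alpha>)" by (rule homog_monomial)
  then show ?case using mono by (simp add: mono_fun_def)
next
  case zero
  show ?case using fs.subspace_0[OF homog_subspace] by (simp add: zero_fun_def)
next
  case (add P P')
  then show ?case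
    using fs.subspace_add[OF homog_subspace add(3,4)] by (simp add: plus_fun_def)
next
  case (scale c P)
  then show ?case
    using fs.subspace_scale[OF homog_subspace scale(2)] by (simp add: fun_scale_def)
qed

lemma poly_translate:
  assumes "P \<in> A"
  shows "(\<lambda>v. P (u + v)) \<in> A"
  using assms
proof (induction rule: poly_induct)
  case (mono \<alpha>)
  have "(\<lambda>v. crd i (u + v)) \<in> A" if "i < n" for i
  proof -
    have "crd i \<in> A" using crd_in_homog[OF that] homog_subset_poly by blast
    then have "(\<lambda>v. crd i u) + crd i \<in> A" by (intro fs.subspace_add[OF poly_subspace] const_in_poly)
    then show ?thesis by (simp add: plus_fun_def crd_add)
  qed
  then have "(\<lambda>v. \<Prod>i<n. crd i (u + v) ^ \<alpha> i) \<in> A" by (rule poly_monomial)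
  then show ?case by (simp add: mono_fun_def)
next
  case zero
  show ?case using fs.subspace_0[OF poly_subspace] by (simp add: zero_fun_def)
next
  case (add P P')
  then show ?case
    using fs.subspace_add[OF poly_subspace add(3,4)] by (simp add: plus_fun_def)
next
  case (scale c P)
  then show ?case
    using fs.subspace_scale[OF poly_subspace scale(2)] by (simp add: fun_scale_def)
qed

text \<open>Both sides unfold to the same difference along a basis vector, by associativity of
  addition; constant-coefficient operators commute with translations.\<close>

lemma partial_derivs_translate: "pd \<beta> (\<lambda>v. P (u + v)) = (\<lambda>v. pd \<beta> P (u + v))"
proof -
  have 1: "partial_deriv sc bs i (\<lambda>v. P (u + v)) = (\<lambda>v. partial_deriv sc bs i P (u + v))" for i P
    unfolding partial_deriv_def by (simp add: add.assoc)
  have 2: "(partial_deriv sc bs i ^^ k) (\<lambda>v. P (u + v)) = (\<lambda>v. (partial_deriv sc bs i ^^ k) P (u + v))"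
    for i k P
    by (induction k) (simp_all add: 1)
  have "foldr (\<lambda>i D. (partial_deriv sc bs i ^^ \<beta> i) \<circ> D) xs id (\<lambda>v. P (u + v))
    = (\<lambda>v. foldr (\<lambda>i D. (partial_deriv sc bs i ^^ \<beta> i) \<circ> D) xs id P (u + v))" for xs
    by (induction xs) (simp_all add: 2)
  then show ?thesis unfolding partial_derivs_def .
qed

text \<open>Identifies the coefficients of a translate with those of the Taylor expansion at
  \<open>u\<close>; the coordinate-free form of the extension depends on it.\<close>

lemma coeff_of_translate:
  "coeff_of \<beta> (\<lambda>v. P (u + v)) = pd \<beta> P u / of_nat (\<Prod>i<n. fact (\<beta> i))"
  unfolding coeff_of_def by (simp add: partial_derivs_translate)

section \<open>Differential operators\<close>

text \<open>Frees the sum from the exact support, so that two operators can be compared over one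
  index set and an operator expanded over a product of index sets.\<close>

lemma weyl_op_eq_sum:
  assumes "P \<in> A" "finite S" "{p. c p \<noteq> 0} \<subseteq> S"
  shows "weyl_op sc bs c P = (\<Sum>(\<alpha>, \<beta>)\<in>S. fun_scale (c (\<alpha>, \<beta>)) (M \<alpha> * pd \<beta> P))"
proof -
  have "weyl_op sc bs c P = (\<Sum>(\<alpha>, \<beta>) | c (\<alpha>, \<beta>) \<noteq> 0. fun_scale (c (\<alpha>, \<beta>)) (M \<alpha> * pd \<beta> P))"
    unfolding weyl_op_def using assms(1) by simp
  also have "{(\<alpha>, \<beta>). c (\<alpha>, \<beta>) \<noteq> 0} = {p. c p \<noteq> 0}" by auto
  also have "(\<Sum>(\<alpha>, \<beta>)\<in>{p. c p \<noteq> 0}. fun_scale (c (\<alpha>, \<beta>)) (M \<alpha> * pd \<beta> P))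
    = (\<Sum>(\<alpha>, \<beta>)\<in>S. fun_scale (c (\<alpha>, \<beta>)) (M \<alpha> * pd \<beta> P))"
    by (rule sum.mono_neutral_left) (use assms in auto)
  finally show ?thesis .
qed

lemma weyl_op_linear:
  assumes "c \<in> weyl_coeffs n"
  shows "linear_between fun_scale A fun_scale A (weyl_op sc bs c)"
proof -
  let ?S = "{p. c p \<noteq> 0}"
  have S: "finite ?S" "?S \<subseteq> MI \<times> MI" using assms unfolding weyl_coeffs_def by auto
  note eq = weyl_op_eq_sum[OF _ S(1) subset_refl]
  note lin = partial_derivs_linear
  show ?thesis
    unfolding linear_between_def
  proof (intro conjI ballI allI)
    show "weyl_op sc bs c ` A \<subseteq> A"
    proof
      fix Q assume "Q \<in> weyl_op sc bs c ` A"
      then obtain P where P: "P \<in> A" "Q = weyl_op sc bs c P" by blast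
      show "Q \<in> A"
        unfolding P(2) eq[OF P(1)]
      proof (rule fs.subspace_sum[OF poly_subspace])
        fix p assume p: "p \<in> ?S"
        obtain \<alpha> \<beta> where ab: "p = (\<alpha>, \<beta>)" by force
        then have "\<alpha> \<in> MI" using p S(2) by auto
        then show "(case p of (\<alpha>, \<beta>) \<Rightarrow> fun_scale (c (\<alpha>, \<beta>)) (M \<alpha> * pd \<beta> P)) \<in> A"
          unfolding ab prod.case
          by (intro fs.subspace_scale[OF poly_subspace] poly_mult mono_fun_in_poly
              linear_between_in[OF lin P(1)])
      qed
    qed
  next
    fix P Q assume PQ: "P \<in> A" "Q \<in> A"
    then have "P + Q \<in> A" by (rule fs.subspace_add[OF poly_subspace])
    then show "weyl_op sc bs c (P + Q) = weyl_op sc bs c P + weyl_op sc bs c Q"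
      using PQ
      by (simp add: eq linear_between_add[OF lin] distrib_left fs.scale_right_distrib
          sum.distrib case_prod_unfold)
  next
    fix a P assume P: "P \<in> A"
    then have "fun_scale a P \<in> A" by (rule fs.subspace_scale[OF poly_subspace])
    then show "weyl_op sc bs c (fun_scale a P) = fun_scale a (weyl_op sc bs c P)"
      using P
      by (simp add: eq linear_between_scale[OF lin] fun_scale_mult_right fs.scale_sum_right
          case_prod_unfold mult.commute)
  qed
qed

section \<open>Uniqueness of coefficients and the degree of an operator\<close>

text \<open>If \<open>\<alpha>\<close> differs from \<open>\<beta>\<close> without having larger
  degree, some exponent of \<open>\<beta>\<close> exceeds that of \<open>\<alpha>\<close>, and the
  falling factorial there is 0.\<close>

lemma partial_derivs_mono_fun_degree_le:
  assumes "\<alpha> \<in> MI" "\<beta> \<in> MI" "tdeg \<alpha> \<le> tdeg \<beta>"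
  shows "pd \<beta> (M \<alpha>) = (if \<alpha> = \<beta> then (\<lambda>v. of_nat (\<Prod>i<n. fact (\<beta> i))) else 0)"
proof (cases "\<alpha> = \<beta>")
  case True
  have "M (\<lambda>i. 0) = (\<lambda>v. 1)" by (simp add: mono_fun_def)
  then show ?thesis
    using True partial_derivs_mono_fun[OF assms(2), of \<beta>] by (simp add: ffact_self fun_scale_def)
next
  case False
  have "\<exists>i<n. \<alpha> i < \<beta> i"
  proof (rule ccontr)
    assume "\<not> ?thesis"
    then have le: "\<beta> i \<le> \<alpha> i" if "i < n" for i using that by (meson not_le)
    have "\<alpha> = \<beta>"
    proof (rule multi_indices_eqI[OF assms(1,2)])
      fix i assume i: "i < n"
      show "\<alpha> i = \<beta> i"
      proof (rule ccontr)
        assume "\<alpha> i \<noteq> \<beta> i"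
        then have "\<beta> i < \<alpha> i" using le[OF i] by simp
        then have "tdeg \<beta> < tdeg \<alpha>" using le i by (intro sum_strict_mono_ex1) auto
        then show False using assms(3) by simp
      qed
    qed
    then show False using False by contradiction
  qed
  then obtain i where i: "i < n" "\<alpha> i < \<beta> i" by blast
  have "ffact (\<alpha> i) (\<beta> i) = 0" using i(2) by (rule ffact_eq_0)
  then have "\<exists>i\<in>{..<n}. ffact (\<alpha> i) (\<beta> i) = 0" using i(1) by blast
  then have "(\<Prod>i<n. ffact (\<alpha> i) (\<beta> i)) = 0" by (rule prod_zero[OF finite_lessThan])
  then show ?thesis using False unfolding partial_derivs_mono_fun[OF assms(1)] by simp
qed

text \<open>An operator applied to \<open>x^\<beta>0\<close>, with \<open>\<beta>0\<close> of least degree among the \<open>\<beta>\<close> that occur, keeps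
  only the terms with \<open>\<beta> = \<beta>0\<close>.\<close>

lemma weyl_op_inj: "inj_on (weyl_op sc bs) (weyl_coeffs n)"
proof (rule inj_onI)
  fix c c' assume c: "c \<in> weyl_coeffs n" "c' \<in> weyl_coeffs n" "weyl_op sc bs c = weyl_op sc bs c'"
  define d where "d p = c p - c' p" for p
  define S where "S = {p. c p \<noteq> 0} \<union> {p. c' p \<noteq> 0}"
  have S: "finite S" "S \<subseteq> MI \<times> MI" using c(1,2) unfolding weyl_coeffs_def S_def by auto
  have d0: "d p = 0" if "p \<notin> S" for p using that unfolding d_def S_def by auto
  have sum0: "(\<Sum>(\<alpha>, \<beta>)\<in>S. fun_scale (d (\<alpha>, \<beta>)) (M \<alpha> * pd \<beta> P)) = 0" if "P \<in> A" for P
  proof -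
    have "(\<Sum>(\<alpha>, \<beta>)\<in>S. fun_scale (d (\<alpha>, \<beta>)) (M \<alpha> * pd \<beta> P))
      = weyl_op sc bs c P - weyl_op sc bs c' P"
      unfolding weyl_op_eq_sum[OF that S(1), of c, unfolded S_def, OF Un_upper1, folded S_def]
        weyl_op_eq_sum[OF that S(1), of c', unfolded S_def, OF Un_upper2, folded S_def]
        d_def sum_subtractf[symmetric]
      by (intro sum.cong) (auto simp: fs.scale_left_diff_distrib)
    then show ?thesis using c(3) by simp
  qed
  have "d p = 0" for p
  proof (rule ccontr)
    assume "d p \<noteq> 0"
    then have "\<exists>\<beta> \<alpha>. d (\<alpha>, \<beta>) \<noteq> 0" by (metis surj_pair)
    then obtain \<beta>0 where "\<exists>\<alpha>. d (\<alpha>, \<beta>0) \<noteq> 0" and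
      least: "\<And>\<beta>. \<exists>\<alpha>. d (\<alpha>, \<beta>) \<noteq> 0 \<Longrightarrow> tdeg \<beta>0 \<le> tdeg \<beta>"
      using ex_has_least_nat[of "\<lambda>\<beta>. \<exists>\<alpha>. d (\<alpha>, \<beta>) \<noteq> 0" _ "\<lambda>\<beta>. tdeg \<beta>"] by blast
    then obtain \<alpha>0 where ab: "d (\<alpha>0, \<beta>0) \<noteq> 0" by blast
    then have "(\<alpha>0, \<beta>0) \<in> S" using d0 by blast
    then have MI0: "\<alpha>0 \<in> MI" "\<beta>0 \<in> MI" using S(2) by auto
    let ?f = "of_nat (\<Prod>i<n. fact (\<beta>0 i)) :: complex"
    \<comment> \<open>Minimality of \<open>\<beta>0\<close> removes the other
      \<open>\<beta>\<close>; among the terms that remain, taking the coefficient at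
      \<open>\<alpha>0\<close> isolates the single pair whose \<open>d\<close> is nonzero.\<close>
    have summand: "coeff_of \<alpha>0 (fun_scale (d (\<alpha>, \<beta>)) (M \<alpha> * pd \<beta> (M \<beta>0)))
      = (if (\<alpha>, \<beta>) = (\<alpha>0, \<beta>0) then d (\<alpha>, \<beta>) * ?f else 0)" if "(\<alpha>, \<beta>) \<in> S" for \<alpha> \<beta>
    proof (cases "d (\<alpha>, \<beta>) = 0")
      case True
      then show ?thesis by (auto simp: coeff_of_zero)
    next
      case False
      have "\<alpha> \<in> MI" "\<beta> \<in> MI" using that S(2) by auto
      have "tdeg \<beta>0 \<le> tdeg \<beta>" using False least by blast
      note pd = partial_derivs_mono_fun_degree_le[OF MI0(2) \<open>\<beta> \<in> MI\<close> this]
      show ?thesis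
      proof (cases "\<beta> = \<beta>0")
        case True
        then have "pd \<beta> (M \<beta>0) = (\<lambda>v. ?f)" using pd by simp
        then have "M \<alpha> * pd \<beta> (M \<beta>0) = fun_scale ?f (M \<alpha>)"
          by (simp only: fun_eq_iff fun_apply mult.commute simp_thms)
        then show ?thesis
          using True mono_fun_in_poly[OF \<open>\<alpha> \<in> MI\<close>] coeff_of_mono_fun[OF \<open>\<alpha> \<in> MI\<close> MI0(1)]
          by (simp add: coeff_of_scale del: of_nat_prod)
      next
        case False
        then show ?thesis using pd by (simp add: coeff_of_zero)
      qed
    qed
    have "(\<Sum>p\<in>S. coeff_of \<alpha>0 (case p of (\<alpha>, \<beta>) \<Rightarrow> fun_scale (d (\<alpha>, \<beta>)) (M \<alpha> * pd \<beta> (M \<beta>0)))) = 0"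
    proof (subst coeff_of_sum[symmetric])
      fix p assume "p \<in> S"
      then show "(case p of (\<alpha>, \<beta>) \<Rightarrow> fun_scale (d (\<alpha>, \<beta>)) (M \<alpha> * pd \<beta> (M \<beta>0))) \<in> A"
        using S(2) linear_between_in[OF partial_derivs_linear mono_fun_in_poly[OF MI0(2)]]
        by (auto intro!: fs.subspace_scale[OF poly_subspace] poly_mult mono_fun_in_poly)
    next
      show "coeff_of \<alpha>0 (\<Sum>p\<in>S. case p of (\<alpha>, \<beta>) \<Rightarrow> fun_scale (d (\<alpha>, \<beta>)) (M \<alpha> * pd \<beta> (M \<beta>0))) = 0"
        using sum0[OF mono_fun_in_poly[OF MI0(2)]] coeff_of_zero by simp
    qed
    moreover have "(\<Sum>p\<in>S. coeff_of \<alpha>0 (case p of (\<alpha>, \<beta>) \<Rightarrow> fun_scale (d (\<alpha>, \<beta>)) (M \<alpha> * pd \<beta> (M \<beta>0))))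
      = (\<Sum>p\<in>S. if p = (\<alpha>0, \<beta>0) then d p * ?f else 0)"
    proof (rule sum.cong[OF refl])
      fix p assume "p \<in> S"
      then show "coeff_of \<alpha>0 (case p of (\<alpha>, \<beta>) \<Rightarrow> fun_scale (d (\<alpha>, \<beta>)) (M \<alpha> * pd \<beta> (M \<beta>0)))
        = (if p = (\<alpha>0, \<beta>0) then d p * ?f else 0)"
        using summand by (cases p) (simp only: prod.case)
    qed
    moreover have "\<dots> = d (\<alpha>0, \<beta>0) * ?f"
      using S(1) \<open>(\<alpha>0, \<beta>0) \<in> S\<close> by (simp add: sum.delta' del: of_nat_prod)
    ultimately show False using ab prod_fact_nonzero[of \<beta>0] by (metis mult_eq_0_iff)
  qed
  then show "c = c'" unfolding d_def by (simp add: fun_eq_iff)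
qed

text \<open>Injectivity of \<open>weyl_op\<close> makes the inverse in \<open>weyl_degree\<close>
  return \<open>c\<close> itself, so negativity becomes a condition on its support.\<close>

lemma weyl_degree_less_0_iff:
  assumes "c \<in> weyl_coeffs n"
  shows "weyl_degree sc bs (weyl_op sc bs c) < 0 \<longleftrightarrow>
    (\<forall>\<alpha> \<beta>. c (\<alpha>, \<beta>) \<noteq> 0 \<longrightarrow> tdeg \<alpha> < tdeg \<beta>)"
proof -
  let ?d = "\<lambda>(\<alpha>, \<beta>). ereal (\<Sum>i<n. real (\<alpha> i) - real (\<beta> i))"
  have deg: "weyl_degree sc bs (weyl_op sc bs c) = (SUP p\<in>{p. c p \<noteq> 0}. ?d p)"
    unfolding weyl_degree_def the_inv_into_f_f[OF weyl_op_inj assms] Let_def ..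
  have d: "?d (\<alpha>, \<beta>) = ereal (real (tdeg \<alpha>) - real (tdeg \<beta>))" for \<alpha> \<beta>
    by (simp add: sum_subtractf)
  show ?thesis
  proof
    assume neg: "weyl_degree sc bs (weyl_op sc bs c) < 0"
    show "\<forall>\<alpha> \<beta>. c (\<alpha>, \<beta>) \<noteq> 0 \<longrightarrow> tdeg \<alpha> < tdeg \<beta>"
    proof (intro allI impI)
      fix \<alpha> \<beta> assume "c (\<alpha>, \<beta>) \<noteq> 0"
      then have "?d (\<alpha>, \<beta>) \<le> (SUP p\<in>{p. c p \<noteq> 0}. ?d p)" by (intro SUP_upper) simp
      then have "?d (\<alpha>, \<beta>) < 0" using neg unfolding deg by (rule le_less_trans)
      then show "tdeg \<alpha> < tdeg \<beta>" unfolding d by (simp del: of_nat_sum)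
    qed
  next
    assume *: "\<forall>\<alpha> \<beta>. c (\<alpha>, \<beta>) \<noteq> 0 \<longrightarrow> tdeg \<alpha> < tdeg \<beta>"
    \<comment> \<open>Strict negativity of each term need not pass to a supremum. The degrees are
      integers, so each is at most -1, and this bound does pass; it also covers the empty
      support.\<close>
    have "(SUP p\<in>{p. c p \<noteq> 0}. ?d p) \<le> ereal (- 1)"
    proof (rule SUP_least)
      fix p assume "p \<in> {p. c p \<noteq> 0}"
      then obtain \<alpha> \<beta> where p: "p = (\<alpha>, \<beta>)" "c (\<alpha>, \<beta>) \<noteq> 0" by (cases p) simp
      then have "real (Suc (tdeg \<alpha>)) \<le> real (tdeg \<beta>)" using * by (intro of_nat_mono Suc_leI) blast
      then show "?d p \<le> ereal (- 1)" unfolding p(1) d by (simp del: of_nat_sum)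
    qed
    also have "ereal (- 1) < 0" by simp
    finally show "weyl_degree sc bs (weyl_op sc bs c) < 0" unfolding deg .
  qed
qed

section \<open>Effect of operators and products on graded parts\<close>

text \<open>For homogeneous \<open>P\<close> of degree \<open>p\<close> the product is zero or
  homogeneous of degree \<open>p + tdeg \<alpha> - tdeg \<beta>\<close>, which is below
  \<open>p\<close> and hence below \<open>j\<close>.\<close>

lemma homog_part_mono_fun_partial_derivs:
  assumes "\<alpha> \<in> MI" "\<beta> \<in> MI" "tdeg \<alpha> < tdeg \<beta>" "P \<in> H p" "p \<le> j"
  shows "homog_part j (M \<alpha> * pd \<beta> P) = 0"
  using assms(4)
proof (induction rule: homog_induct)
  case (mono \<gamma>)
  show ?case
  proof (cases "\<forall>i<n. \<beta> i \<le> \<gamma> i")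
    case True
    have "(\<lambda>i. \<gamma> i - \<beta> i) \<in> MI" using mono(1) by (auto simp: multi_indices_def)
    then have "M (\<lambda>i. \<alpha> i + (\<gamma> i - \<beta> i)) \<in> H (\<Sum>i<n. \<alpha> i + (\<gamma> i - \<beta> i))"
      by (intro mono_fun_in_homog multi_indices_add assms(1)) auto
    \<comment> \<open>The degree count is stated additively because subtraction is truncated; it is
      exact where \<open>\<beta> i \<le> \<gamma> i\<close>, as in this case.\<close>
    moreover have "(\<Sum>i<n. \<alpha> i + (\<gamma> i - \<beta> i)) + tdeg \<beta> = tdeg \<alpha> + tdeg \<gamma>"
      unfolding sum.distrib[symmetric] using True by (intro sum.cong) auto
    then have "(\<Sum>i<n. \<alpha> i + (\<gamma> i - \<beta> i)) < j" using assms(3,5) mono(2) by linarith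
    ultimately have "homog_part j (M (\<lambda>i. \<alpha> i + (\<gamma> i - \<beta> i))) = 0" by (simp add: homog_part_homog)
    moreover have "M (\<lambda>i. \<alpha> i + (\<gamma> i - \<beta> i)) \<in> A"
      using \<open>(\<lambda>i. \<gamma> i - \<beta> i) \<in> MI\<close> by (intro mono_fun_in_poly multi_indices_add assms(1))
    ultimately show ?thesis
      unfolding partial_derivs_mono_fun[OF mono(1)] fun_scale_mult_right mono_fun_times
      by (simp add: linear_between_scale[OF homog_part_linear])
  next
    case False
    then obtain i where i: "i < n" "\<gamma> i < \<beta> i" by (meson not_le)
    have "ffact (\<gamma> i) (\<beta> i) = 0" using i(2) by (rule ffact_eq_0)
    then have "\<exists>i\<in>{..<n}. ffact (\<gamma> i) (\<beta> i) = 0" using i(1) by blast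
    then have "(\<Prod>i<n. ffact (\<gamma> i) (\<beta> i)) = 0" by (rule prod_zero[OF finite_lessThan])
    then have "pd \<beta> (M \<gamma>) = 0"
      unfolding partial_derivs_mono_fun[OF mono(1)] by (simp only: of_nat_0 fs.scale_zero_left)
    then show ?thesis by (simp add: homog_part_zero)
  qed
next
  case zero
  have "pd \<beta> 0 = 0"
    by (rule linear_between_zero[OF partial_derivs_linear vector_space_fun_scale poly_subspace])
  then show ?case by (simp add: homog_part_zero)
next
  case (add P P')
  have P: "P \<in> A" "P' \<in> A" using add homog_subset_poly by blast+
  then have "M \<alpha> * pd \<beta> P \<in> A" "M \<alpha> * pd \<beta> P' \<in> A"
    by (auto intro!: poly_mult mono_fun_in_poly assms(1) linear_between_in[OF partial_derivs_linear])
  then show ?case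
    using add P
    by (simp add: linear_between_add[OF partial_derivs_linear] distrib_left
        linear_between_add[OF homog_part_linear])
next
  case (scale c P)
  have P: "P \<in> A" using scale homog_subset_poly by blast
  then have "M \<alpha> * pd \<beta> P \<in> A"
    by (auto intro!: poly_mult mono_fun_in_poly assms(1) linear_between_in[OF partial_derivs_linear])
  then show ?case
    using scale P
    by (simp add: linear_between_scale[OF partial_derivs_linear] fun_scale_mult_right
        linear_between_scale[OF homog_part_linear])
qed

lemma homog_part_weyl_op_negative:
  assumes "c \<in> weyl_coeffs n" "weyl_degree sc bs (weyl_op sc bs c) < 0" "P \<in> H p" "p \<le> j"
  shows "homog_part j (weyl_op sc bs c P) = 0"
proof -
  let ?S = "{p. c p \<noteq> 0}"
  have S: "finite ?S" "?S \<subseteq> MI \<times> MI" using assms(1) unfolding weyl_coeffs_def by auto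
  have P: "P \<in> A" using assms(3) homog_subset_poly by blast
  have "homog_part j (weyl_op sc bs c P)
    = (\<Sum>p\<in>?S. homog_part j (case p of (\<alpha>, \<beta>) \<Rightarrow> fun_scale (c (\<alpha>, \<beta>)) (M \<alpha> * pd \<beta> P)))"
    unfolding weyl_op_eq_sum[OF P S(1) subset_refl]
  proof (rule linear_between_sum[OF homog_part_linear vector_space_fun_scale poly_subspace])
    fix p assume "p \<in> ?S"
    then show "(case p of (\<alpha>, \<beta>) \<Rightarrow> fun_scale (c (\<alpha>, \<beta>)) (M \<alpha> * pd \<beta> P)) \<in> A"
      using S(2) linear_between_in[OF partial_derivs_linear P]
      by (auto intro!: fs.subspace_scale[OF poly_subspace] poly_mult mono_fun_in_poly)
  qed
  also have "\<dots> = (\<Sum>p\<in>?S. 0)"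
  proof (rule sum.cong[OF refl])
    fix p assume p: "p \<in> ?S"
    obtain \<alpha> \<beta> where ab: "p = (\<alpha>, \<beta>)" by force
    have MI: "\<alpha> \<in> MI" "\<beta> \<in> MI" using p S(2) ab by auto
    have "tdeg \<alpha> < tdeg \<beta>" using assms(2) p ab unfolding weyl_degree_less_0_iff[OF assms(1)] by blast
    then have "homog_part j (M \<alpha> * pd \<beta> P) = 0" by (rule homog_part_mono_fun_partial_derivs[OF MI _ assms(3,4)])
    moreover have "M \<alpha> * pd \<beta> P \<in> A"
      by (intro poly_mult mono_fun_in_poly MI linear_between_in[OF partial_derivs_linear P])
    ultimately show "homog_part j (case p of (\<alpha>, \<beta>) \<Rightarrow> fun_scale (c (\<alpha>, \<beta>)) (M \<alpha> * pd \<beta> P)) = 0"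
      unfolding ab prod.case by (simp add: linear_between_scale[OF homog_part_linear])
  qed
  finally show ?thesis by simp
qed

text \<open>Nonconstant monomials of \<open>Q\<close> push the product above degree
  \<open>k\<close>, so only the constant term \<open>Q 0\<close> contributes.\<close>

lemma homog_part_mult_homog:
  assumes "Q \<in> A" "F \<in> H k"
  shows "homog_part k (Q * F) = fun_scale (Q 0) F"
  using assms(1)
proof (induction rule: poly_induct)
  case (mono \<gamma>)
  have prod: "M \<gamma> * F \<in> H (tdeg \<gamma> + k)"
    using mono_fun_in_homog[OF mono refl] assms(2) by (rule homog_mult)
  show ?case
  proof (cases "\<forall>i<n. \<gamma> i = 0")
    case True
    then have "M \<gamma> = (\<lambda>v. 1)" "M \<gamma> 0 = 1" "tdeg \<gamma> = 0" by (auto simp: mono_fun_def)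
    moreover from this have "M \<gamma> * F = F" by (simp add: fun_eq_iff fun_apply)
    ultimately show ?thesis using prod by (simp add: homog_part_homog)
  next
    case False
    then have "M \<gamma> 0 = 0" unfolding mono_fun_zero by (rule if_not_P)
    moreover have "tdeg \<gamma> \<noteq> 0" using False by (auto simp: sum_eq_0_iff)
    then have "k \<noteq> tdeg \<gamma> + k" by linarith
    then have "homog_part k (M \<gamma> * F) = 0" unfolding homog_part_homog[OF prod] by (rule if_not_P)
    ultimately show ?thesis by (simp only: fs.scale_zero_left)
  qed
next
  case zero
  have "(0 :: 'v \<Rightarrow> complex) 0 = 0" by (rule zero_fun_apply)
  then show ?case by (simp only: mult_zero_left homog_part_zero fs.scale_zero_left)
next
  case (add P P')
  have "F \<in> A" using assms(2) homog_subset_poly by blast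
  then have "P * F \<in> A" "P' * F \<in> A" using add by (auto intro: poly_mult)
  then show ?case
    using add by (simp add: distrib_right linear_between_add[OF homog_part_linear]
        plus_fun_apply[of P P' 0] fs.scale_left_distrib)
next
  case (scale c P)
  have "F \<in> A" using assms(2) homog_subset_poly by blast
  then have "P * F \<in> A" using scale by (auto intro: poly_mult)
  then show ?case
    using scale
    by (simp add: fun_scale_mult_left linear_between_scale[OF homog_part_linear]
        fun_scale_apply[of c P 0])
qed

section \<open>Extending maps between graded pieces to operators\<close>

text \<open>The Weyl operator that extends \<open>\<phi> : H m \<rightarrow> H k\<close> by applying it to the degree \<open>m\<close> term
  of the Taylor expansion at \<open>v\<close>; this description does not involve the basis.\<close>

definition extension_coeffs ::
  "nat \<Rightarrow> nat \<Rightarrow> (('v \<Rightarrow> complex) \<Rightarrow> 'v \<Rightarrow> complex) \<Rightarrow> (nat \<Rightarrow> nat) \<times> (nat \<Rightarrow> nat) \<Rightarrow> complex" where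
  "extension_coeffs m k \<phi> = (\<lambda>(\<alpha>, \<beta>). if \<alpha> \<in> I k \<and> \<beta> \<in> I m
     then coeff_of \<alpha> (\<phi> (M \<beta>)) / of_nat (\<Prod>i<n. fact (\<beta> i)) else 0)"

lemma extension_coeffs_support: "{p. extension_coeffs m k \<phi> p \<noteq> 0} \<subseteq> I k \<times> I m"
  unfolding extension_coeffs_def by (auto split: if_splits)

lemma extension_coeffs_in: "extension_coeffs m k \<phi> \<in> weyl_coeffs n"
proof -
  have "finite (I k \<times> I m)" by (intro finite_cartesian_product finite_multi_indices_of_degree)
  then have "finite {p. extension_coeffs m k \<phi> p \<noteq> 0}"
    using extension_coeffs_support by (rule rev_finite_subset)
  then show ?thesis using extension_coeffs_support[of m k \<phi>] unfolding weyl_coeffs_def by blast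
qed

context
  fixes m k :: nat and \<phi>
  assumes \<phi>: "linear_between fun_scale (H m) fun_scale (H k) \<phi>"
begin

text \<open>Summing over \<open>\<alpha>\<close> first reassembles \<open>\<phi> (M \<beta>)\<close>
  from its coefficients. Both later descriptions of the operator, at a point and in degree
  \<open>k\<close>, start from this form.\<close>

lemma extension_op_eq_sum:
  assumes "P \<in> A"
  shows "weyl_op sc bs (extension_coeffs m k \<phi>) P =
    (\<Sum>\<beta>\<in>I m. fun_scale (1 / of_nat (\<Prod>i<n. fact (\<beta> i))) (pd \<beta> P * \<phi> (M \<beta>)))"
proof -
  let ?c = "extension_coeffs m k \<phi>"
  have fin: "finite (I k \<times> I m)" by (intro finite_cartesian_product finite_multi_indices_of_degree)
  have "weyl_op sc bs ?c P = (\<Sum>(\<alpha>, \<beta>)\<in>I k \<times> I m. fun_scale (?c (\<alpha>, \<beta>)) (M \<alpha> * pd \<beta> P))"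
    by (rule weyl_op_eq_sum[OF assms fin extension_coeffs_support])
  also have "\<dots> = (\<Sum>\<alpha>\<in>I k. \<Sum>\<beta>\<in>I m. fun_scale (?c (\<alpha>, \<beta>)) (M \<alpha> * pd \<beta> P))"
    by (rule sum.cartesian_product[symmetric])
  also have "\<dots> = (\<Sum>\<beta>\<in>I m. \<Sum>\<alpha>\<in>I k. fun_scale (?c (\<alpha>, \<beta>)) (M \<alpha> * pd \<beta> P))"
    by (rule sum.swap)
  also have "\<dots> = (\<Sum>\<beta>\<in>I m. fun_scale (1 / of_nat (\<Prod>i<n. fact (\<beta> i))) (pd \<beta> P * \<phi> (M \<beta>)))"
  proof (rule sum.cong[OF refl])
    fix \<beta> assume \<beta>: "\<beta> \<in> I m"
    then have "\<phi> (M \<beta>) \<in> H k" by (intro linear_between_in[OF \<phi>] mono_fun_in_homog) auto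
    then have "\<phi> (M \<beta>) = homog_part k (\<phi> (M \<beta>))" by (simp add: homog_part_homog)
    then have eq: "\<phi> (M \<beta>) = (\<Sum>\<alpha>\<in>I k. fun_scale (coeff_of \<alpha> (\<phi> (M \<beta>))) (M \<alpha>))"
      unfolding homog_part_def .
    have "fun_scale (1 / of_nat (\<Prod>i<n. fact (\<beta> i))) (pd \<beta> P * \<phi> (M \<beta>)) =
      (\<Sum>\<alpha>\<in>I k. fun_scale (1 / of_nat (\<Prod>i<n. fact (\<beta> i)))
        (pd \<beta> P * fun_scale (coeff_of \<alpha> (\<phi> (M \<beta>))) (M \<alpha>)))"
      by (subst eq) (simp only: sum_distrib_left fs.scale_sum_right)
    also have "\<dots> = (\<Sum>\<alpha>\<in>I k. fun_scale (?c (\<alpha>, \<beta>)) (M \<alpha> * pd \<beta> P))"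
      by (rule sum.cong[OF refl])
        (use \<beta> in \<open>simp add: extension_coeffs_def fun_scale_mult_right mult.commute del: of_nat_prod\<close>)
    finally show "(\<Sum>\<alpha>\<in>I k. fun_scale (?c (\<alpha>, \<beta>)) (M \<alpha> * pd \<beta> P)) =
      fun_scale (1 / of_nat (\<Prod>i<n. fact (\<beta> i))) (pd \<beta> P * \<phi> (M \<beta>))" ..
  qed
  finally show ?thesis .
qed

lemma apply_homog_part:
  "\<phi> (homog_part m P) = (\<Sum>\<beta>\<in>I m. fun_scale (coeff_of \<beta> P) (\<phi> (M \<beta>)))"
proof -
  have "\<phi> (homog_part m P) = (\<Sum>\<beta>\<in>I m. \<phi> (fun_scale (coeff_of \<beta> P) (M \<beta>)))"
    unfolding homog_part_def
    by (rule linear_between_sum[OF \<phi> vector_space_fun_scale homog_subspace])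
      (auto intro!: fs.subspace_scale[OF homog_subspace] mono_fun_in_homog)
  also have "\<dots> = (\<Sum>\<beta>\<in>I m. fun_scale (coeff_of \<beta> P) (\<phi> (M \<beta>)))"
    by (intro sum.cong refl linear_between_scale[OF \<phi>] mono_fun_in_homog) auto
  finally show ?thesis .
qed

lemma extension_op_apply:
  assumes "P \<in> A"
  shows "weyl_op sc bs (extension_coeffs m k \<phi>) P v = \<phi> (homog_part m (\<lambda>w. P (v + w))) v"
  unfolding extension_op_eq_sum[OF assms] apply_homog_part sum_fun_apply
  by (intro sum.cong refl) (simp add: fun_apply coeff_of_translate del: of_nat_prod)

text \<open>By \<open>homog_part_mult_homog\<close> each factor \<open>pd \<beta> P\<close> counts
  only through its value at 0, which after division by the factorials is the coefficient of
  \<open>P\<close>.\<close>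

lemma homog_part_extension_op:
  assumes "P \<in> A"
  shows "homog_part k (weyl_op sc bs (extension_coeffs m k \<phi>) P) = \<phi> (homog_part m P)"
proof -
  have Hk: "\<phi> (M \<beta>) \<in> H k" if "\<beta> \<in> I m" for \<beta>
    using that by (intro linear_between_in[OF \<phi>] mono_fun_in_homog) auto
  have pdA: "pd \<beta> P \<in> A" for \<beta> using linear_between_in[OF partial_derivs_linear assms] .
  have in_A: "pd \<beta> P * \<phi> (M \<beta>) \<in> A" if "\<beta> \<in> I m" for \<beta>
    using Hk[OF that] homog_subset_poly by (intro poly_mult pdA) auto
  have "homog_part k (weyl_op sc bs (extension_coeffs m k \<phi>) P) =
    (\<Sum>\<beta>\<in>I m. homog_part k (fun_scale (1 / of_nat (\<Prod>i<n. fact (\<beta> i))) (pd \<beta> P * \<phi> (M \<beta>))))"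
    unfolding extension_op_eq_sum[OF assms]
    by (rule linear_between_sum[OF homog_part_linear vector_space_fun_scale poly_subspace])
      (intro fs.subspace_scale[OF poly_subspace] in_A)
  also have "\<dots> = (\<Sum>\<beta>\<in>I m. fun_scale (coeff_of \<beta> P) (\<phi> (M \<beta>)))"
  proof (rule sum.cong[OF refl])
    fix \<beta> assume \<beta>: "\<beta> \<in> I m"
    show "homog_part k (fun_scale (1 / of_nat (\<Prod>i<n. fact (\<beta> i))) (pd \<beta> P * \<phi> (M \<beta>))) =
      fun_scale (coeff_of \<beta> P) (\<phi> (M \<beta>))"
      using linear_between_scale[OF homog_part_linear in_A[OF \<beta>]] homog_part_mult_homog[OF pdA Hk[OF \<beta>]]
      by (simp add: coeff_of_def del: of_nat_prod)
  qed
  finally show ?thesis by (simp add: apply_homog_part)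
qed

end

end

section \<open>The group action on polynomials\<close>

locale polynomial_rep = based_space sc bs + G: group G
  for sc :: "complex \<Rightarrow> 'v::ab_group_add \<Rightarrow> 'v" and bs :: "'v list"
    and G :: "('g, 'r) monoid_scheme" +
  fixes \<rho> :: "'g \<Rightarrow> 'v \<Rightarrow> 'v"
  assumes finite_group: "finite (carrier G)" and rep: "group_rep G sc UNIV \<rho>"
begin

abbreviation act where "act \<equiv> fun_act G \<rho>"

lemma act_apply: "act g P v = P (\<rho> (inv\<^bsub>G\<^esub> g) v)"
  by (simp add: fun_act_def)

lemma rho_linear:
  assumes "g \<in> carrier G"
  shows "\<rho> g (u + v) = \<rho> g u + \<rho> g v" "\<rho> g (sc c v) = sc c (\<rho> g v)"
  using linear_between_add[OF group_rep_linear[OF rep assms]]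
    linear_between_scale[OF group_rep_linear[OF rep assms]] by auto

text \<open>Stated on all functions rather than on polynomials, because
  \<open>maschke_projection\<close> works on a whole type.\<close>

lemma act_rep: "group_rep G fun_scale UNIV act"
proof -
  have "act \<one>\<^bsub>G\<^esub> P = P" for P
    using rep unfolding group_rep_def fun_act_def by simp
  moreover have "act (g \<otimes>\<^bsub>G\<^esub> h) P = act g (act h P)" if "g \<in> carrier G" "h \<in> carrier G" for g h P
    using rep that unfolding group_rep_def fun_act_def by (simp add: G.inv_mult_group)
  moreover have "linear_between fun_scale UNIV fun_scale UNIV (act g)" for g
    unfolding linear_between_def fun_act_def by (auto simp: fun_eq_iff fun_apply)
  ultimately show ?thesis
    unfolding group_rep_def using vector_space_fun_scale fs.subspace_UNIV by blast
qed

lemma act_linear: "g \<in> carrier G \<Longrightarrow> linear_between fun_scale UNIV fun_scale UNIV (act g)"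
  using group_rep_linear[OF act_rep] .

lemma act_homog: "g \<in> carrier G \<Longrightarrow> P \<in> H m \<Longrightarrow> act g P \<in> H m"
  unfolding fun_act_def by (rule homog_compose_linear) (simp_all add: rho_linear)

lemma act_sum_homog_part:
  assumes "g \<in> carrier G" "P \<in> A"
  obtains N where "act g P = (\<Sum>m<N. act g (homog_part m P))" "\<And>m. N \<le> m \<Longrightarrow> homog_part m P = 0"
proof -
  obtain N where N: "\<forall>N'\<ge>N. P = (\<Sum>m<N'. homog_part m P)" using poly_eq_sum_homog_part[OF assms(2)] by blast
  have "homog_part m P = 0" if "N \<le> m" for m
  proof -
    \<comment> \<open>Beyond the bound two consecutive partial sums both equal \<open>P\<close>, so
      the term between them is zero.\<close>
    have "P = (\<Sum>m<Suc m. homog_part m P)" "P = (\<Sum>m<m. homog_part m P)" using N that le_SucI by blast+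
    then show ?thesis by (metis add_cancel_right_right sum.lessThan_Suc)
  qed
  moreover have "act g P = act g (\<Sum>m<N. homog_part m P)" using N by simp
  then have "act g P = (\<Sum>m<N. act g (homog_part m P))"
    using linear_between_sum[OF act_linear[OF assms(1)] vector_space_fun_scale fs.subspace_UNIV] by simp
  ultimately show thesis using that by blast
qed

lemma act_poly:
  assumes "g \<in> carrier G" "P \<in> A"
  shows "act g P \<in> A"
proof -
  obtain N where "act g P = (\<Sum>m<N. act g (homog_part m P))" using act_sum_homog_part[OF assms] by blast
  moreover have "\<dots> \<in> A"
    using act_homog[OF assms(1) homog_part_in[OF assms(2)]] homog_subset_poly
    by (intro fs.subspace_sum[OF poly_subspace]) blast
  ultimately show ?thesis by simp
qed

text \<open>The action maps each graded piece to itself, so the translates of the parts of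
  \<open>P\<close> are the parts of the translate.\<close>

lemma homog_part_act:
  assumes "g \<in> carrier G" "P \<in> A"
  shows "homog_part m (act g P) = act g (homog_part m P)"
proof -
  obtain N where N: "act g P = (\<Sum>m<N. act g (homog_part m P))" "\<And>m. N \<le> m \<Longrightarrow> homog_part m P = 0"
    using act_sum_homog_part[OF assms] by blast
  have H: "act g (homog_part j P) \<in> H j" for j using act_homog[OF assms(1) homog_part_in[OF assms(2)]] .
  have "homog_part m (act g P) = (\<Sum>j<N. homog_part m (act g (homog_part j P)))"
    unfolding N(1)
    by (rule linear_between_sum[OF homog_part_linear vector_space_fun_scale poly_subspace])
      (use H homog_subset_poly in blast)
  also have "\<dots> = (\<Sum>j<N. if j = m then act g (homog_part m P) else 0)"
    by (rule sum.cong) (auto simp: homog_part_homog[OF H])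
  also have "\<dots> = act g (homog_part m P)"
  proof (cases "m < N")
    case False
    have "act g 0 = 0"
      using linear_between_zero[OF act_linear[OF assms(1)] vector_space_fun_scale fs.subspace_UNIV] .
    then show ?thesis using False N(2)[of m] by (simp add: sum.delta')
  qed (simp add: sum.delta')
  finally show ?thesis .
qed

lemma homog_subrep: "subrep G fun_scale (H m) UNIV act"
  unfolding subrep_def using homog_subspace act_homog by auto

lemma homog_rep: "group_rep G fun_scale (H m) act"
  by (rule group_rep_subrep[OF act_rep homog_subrep])

text \<open>Invariance of the extension is read off from its coordinate-free description.\<close>

lemma extension_op_neg_invariant:
  assumes \<phi>: "linear_between fun_scale (H m) fun_scale (H k) \<phi>"
    and equi: "\<And>g P. g \<in> carrier G \<Longrightarrow> P \<in> H m \<Longrightarrow> \<phi> (act g P) = act g (\<phi> P)"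
    and "k < m"
  shows "weyl_op sc bs (extension_coeffs m k \<phi>) \<in> neg_invariant_ops G sc bs \<rho>"
proof -
  let ?c = "extension_coeffs m k \<phi>" and ?D = "weyl_op sc bs (extension_coeffs m k \<phi>)"
  have "tdeg \<alpha> < tdeg \<beta>" if "?c (\<alpha>, \<beta>) \<noteq> 0" for \<alpha> \<beta>
    using that extension_coeffs_support[of m k \<phi>] assms(3) by auto
  then have "weyl_degree sc bs ?D < 0"
    unfolding weyl_degree_less_0_iff[OF extension_coeffs_in] by blast
  moreover have "op_act G sc bs \<rho> g ?D = ?D" if g: "g \<in> carrier G" for g
  proof
    fix P
    note g' = G.inv_closed[OF g]
    show "op_act G sc bs \<rho> g ?D P = ?D P"
    proof (cases "P \<in> A")
      case True
      have "op_act G sc bs \<rho> g ?D P v = ?D P v" for v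
      proof -
        let ?u = "\<rho> (inv\<^bsub>G\<^esub> g) v"
        have u: "\<rho> g ?u = v" using group_rep_inv[OF G.group_axioms rep g] by simp
        have P': "(\<lambda>w. P (v + w)) \<in> A" using True by (rule poly_translate)
        \<comment> \<open>By linearity of \<open>\<rho> g\<close> and
          \<open>\<rho> g ?u = v\<close>, expanding the translated polynomial at \<open>?u\<close>
          is the same as translating the expansion at \<open>v\<close>; then \<open>\<phi>\<close>
          and \<open>homog_part\<close> commute with the action.\<close>
        have "(\<lambda>w. act (inv\<^bsub>G\<^esub> g) P (?u + w)) = act (inv\<^bsub>G\<^esub> g) (\<lambda>w. P (v + w))"
          using g u by (simp add: fun_eq_iff act_apply rho_linear)
        then have "op_act G sc bs \<rho> g ?D P v = \<phi> (homog_part m (act (inv\<^bsub>G\<^esub> g) (\<lambda>w. P (v + w)))) ?u"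
          unfolding op_act_def using True
          by (simp add: act_apply extension_op_apply[OF \<phi> act_poly[OF g' True]])
        also have "\<dots> = act (inv\<^bsub>G\<^esub> g) (\<phi> (homog_part m (\<lambda>w. P (v + w)))) ?u"
          by (simp add: homog_part_act[OF g' P'] equi[OF g' homog_part_in[OF P']])
        also have "\<dots> = \<phi> (homog_part m (\<lambda>w. P (v + w))) v" using g u by (simp add: act_apply)
        also have "\<dots> = ?D P v" by (simp add: extension_op_apply[OF \<phi> True])
        finally show ?thesis .
      qed
      then show ?thesis by (rule ext)
    next
      case False
      \<comment> \<open>Outside the polynomials both operators take the default value of
        \<open>restrict\<close>.\<close>
      then show ?thesis unfolding op_act_def weyl_op_def by simp
    qed
  qed
  ultimately show ?thesis
    unfolding neg_invariant_ops_def weyl_algebra_def using extension_coeffs_in by blast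
qed

section \<open>Maps to lower degrees and models of irreducibles\<close>

text \<open>Linearity and equivariance are asked on \<open>H m\<close> only, and the target degree
  is left open, so the notion is stable under composition with equivariant projections within
  \<open>H m\<close>.\<close>

definition intertwines_down :: "nat \<Rightarrow> (('v \<Rightarrow> complex) \<Rightarrow> 'v \<Rightarrow> complex) \<Rightarrow> bool" where
  "intertwines_down m \<phi> \<longleftrightarrow> (\<exists>k<m. linear_between fun_scale (H m) fun_scale (H k) \<phi>) \<and>
     (\<forall>g\<in>carrier G. \<forall>P\<in>H m. \<phi> (act g P) = act g (\<phi> P))"

lemma polynomial_model_homog_part_annihilated:
  assumes "P \<in> polynomial_model G sc bs \<rho>" "intertwines_down m \<phi>"
  shows "\<phi> (homog_part m P) = 0"
proof -
  obtain k where k: "k < m" "linear_between fun_scale (H m) fun_scale (H k) \<phi>"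
    using assms(2) unfolding intertwines_down_def by blast
  have equi: "\<phi> (act g P) = act g (\<phi> P)" if "g \<in> carrier G" "P \<in> H m" for g P
    using assms(2) that unfolding intertwines_down_def by blast
  have P: "P \<in> A" using assms(1) unfolding polynomial_model_def by blast
  have "weyl_op sc bs (extension_coeffs m k \<phi>) P = 0"
    using extension_op_neg_invariant[OF k(2) equi k(1)] assms(1) unfolding polynomial_model_def by blast
  then show ?thesis using homog_part_extension_op[OF k(2) P] by (simp add: homog_part_zero)
qed

text \<open>Isomorphism classes are represented on subspaces of
  \<open>nat \<Rightarrow> complex\<close>; a subspace of \<open>H m\<close> moves there through its
  finitely many coefficients.\<close>

lemma exists_model_rep:
  assumes F: "subrep G fun_scale F (H m) act" "irreducible_rep G fun_scale F act"
  shows "\<exists>U\<in>irreps G. iso_rep G fun_scale (fst U) (snd U) fun_scale F act"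
proof -
  obtain e where e: "bij_betw e {0..<card (I m)} (I m)"
    using ex_bij_betw_nat_finite[OF finite_multi_indices_of_degree] by blast
  \<comment> \<open>\<open>e\<close> enumerates the exponents of degree \<open>m\<close>; the
    coefficient vector is padded with zeros to a sequence.\<close>
  define \<psi> where "\<psi> P = (\<lambda>i. if i < card (I m) then coeff_of (e i) P else 0)" for P
  have FH: "F \<subseteq> H m" "fs.subspace F" using F(1) unfolding subrep_def by blast+
  then have FA: "F \<subseteq> A" using homog_subset_poly by blast
  have grF: "group_rep G fun_scale F act" using F(2) unfolding irreducible_rep_def by blast
  have lin: "linear_between fun_scale F fun_scale UNIV \<psi>"
    unfolding linear_between_def \<psi>_def using FA
    by (auto simp: fun_eq_iff fun_apply coeff_of_add coeff_of_scale subset_iff)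
  have inj: "inj_on \<psi> F"
  proof (rule linear_between_inj_onI[OF lin vector_space_fun_scale FH(2)])
    fix P assume P: "P \<in> F" "\<psi> P = 0"
    have "coeff_of \<alpha> P = 0" if \<alpha>: "\<alpha> \<in> I m" for \<alpha>
    proof -
      have "\<alpha> \<in> e ` {0..<card (I m)}" using \<alpha> unfolding bij_betw_imp_surj_on[OF e] .
      then obtain i where "\<alpha> = e i" "i \<in> {0..<card (I m)}" by (rule imageE)
      then show ?thesis using fun_cong[OF P(2), of i] unfolding \<psi>_def by (simp add: fun_apply)
    qed
    then have "homog_part m P = 0" unfolding homog_part_def by simp
    then show "P = 0" using homog_part_eq_0D P(1) FH(1) by blast
  qed
  define U where "U = (\<psi> ` F, \<lambda>g y. \<psi> (act g (inv_into F \<psi> y)))"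
  have iso: "iso_rep G fun_scale F act fun_scale (fst U) (snd U)"
    unfolding iso_rep_def
  proof (intro exI[of _ \<psi>] conjI ballI)
    show "bij_betw \<psi> F (fst U)" using inj by (simp add: U_def inj_on_imp_bij_betw)
    show "linear_between fun_scale F fun_scale (fst U) \<psi>"
      by (rule linear_between_mono[OF lin]) (auto simp: U_def)
  qed (simp add: U_def inv_into_f_f[OF inj])
  then have "irreducible_rep G fun_scale (fst U) (snd U)"
    by (rule iso_rep_irreducible[OF _ F(2) vector_space_fun_scale G.group_axioms])
  then show ?thesis unfolding irreps_def using iso_rep_sym[OF iso grF] by blast
qed

lemma first_degree_le:
  assumes "subrep G fun_scale F (H m) act" "iso_rep G fun_scale (fst U) (snd U) fun_scale F act"
  shows "first_degree G sc bs \<rho> U \<le> m"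
  unfolding first_degree_def using assms by (intro Least_le) blast

text \<open>The occurrence in degree \<open>m\<close> is what gives the \<open>LEAST\<close> in
  \<open>first_degree\<close> its defining property.\<close>

lemma first_degree_realized:
  assumes "subrep G fun_scale F (H m) act" "iso_rep G fun_scale (fst U) (snd U) fun_scale F act"
  shows "\<exists>F. subrep G fun_scale F (H (first_degree G sc bs \<rho> U)) act \<and>
    iso_rep G fun_scale (fst U) (snd U) fun_scale F act"
  unfolding first_degree_def by (rule LeastI_ex) (use assms in blast)

lemma polynomial_model_subspace: "fs.subspace (polynomial_model G sc bs \<rho>)"
proof -
  have lin: "linear_between fun_scale A fun_scale A D" if "D \<in> neg_invariant_ops G sc bs \<rho>" for D
    using that weyl_op_linear unfolding neg_invariant_ops_def weyl_algebra_def by blast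
  show ?thesis
    unfolding polynomial_model_def
    by (rule fs.subspaceI)
      (auto simp: fs.subspace_0[OF poly_subspace] fs.subspace_add[OF poly_subspace]
        fs.subspace_scale[OF poly_subspace] linear_between_add[OF lin] linear_between_scale[OF lin]
        linear_between_zero[OF lin vector_space_fun_scale poly_subspace])
qed

section \<open>The two inclusions and independence\<close>

lemma first_component_subset_model:
  assumes U: "irreducible_rep G fun_scale (fst U) (snd U)"
  shows "first_component G sc bs \<rho> U \<subseteq> polynomial_model G sc bs \<rho>"
proof -
  let ?p = "first_degree G sc bs \<rho> U"
  have "P \<in> polynomial_model G sc bs \<rho>"
    if F: "subrep G fun_scale F (H ?p) act" "iso_rep G fun_scale (fst U) (snd U) fun_scale F act"
      and P: "P \<in> F" for F P
  proof -
    have irrF: "irreducible_rep G fun_scale F act"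
      by (rule iso_rep_irreducible[OF F(2) U vector_space_fun_scale G.group_axioms])
    have FH: "F \<subseteq> H ?p" using F(1) unfolding subrep_def by blast
    then have FA: "F \<subseteq> A" using homog_subset_poly by blast
    have "D P = 0" if D: "D \<in> neg_invariant_ops G sc bs \<rho>" for D
    proof (rule ccontr)
      assume nz: "D P \<noteq> 0"
      obtain c where c: "c \<in> weyl_coeffs n" "D = weyl_op sc bs c"
        using D unfolding neg_invariant_ops_def weyl_algebra_def by blast
      have deg: "weyl_degree sc bs (weyl_op sc bs c) < 0"
        using D unfolding c(2) neg_invariant_ops_def by blast
      have lin: "linear_between fun_scale A fun_scale A D"
        unfolding c(2) by (rule weyl_op_linear[OF c(1)])
      have inv: "D (act g Q) = act g (D Q)" if g: "g \<in> carrier G" and Q: "Q \<in> A" for g Q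
      proof -
        \<comment> \<open>Invariance is evaluated at \<open>act g Q\<close>, so that the inner
          inverse action gives back \<open>Q\<close>.\<close>
        have "D (act g Q) = op_act G sc bs \<rho> g D (act g Q)"
          using D g unfolding neg_invariant_ops_def by simp
        also have "\<dots> = act g (D (act (inv\<^bsub>G\<^esub> g) (act g Q)))"
          unfolding op_act_def using act_poly[OF g Q] by simp
        finally show ?thesis using group_rep_inv(2)[OF G.group_axioms act_rep g] by simp
      qed
      have "D P \<in> A" using linear_between_in[OF lin] P FA by blast
      \<comment> \<open>\<open>D P\<close> may spread over several degrees; one nonzero part
        suffices, and negativity of the degree forces \<open>j < ?p\<close>. By Schur's lemma it
        embeds \<open>F\<close> in \<open>H j\<close>, against the minimality of
        \<open>?p\<close>.\<close>
      then obtain j where j: "homog_part j (D P) \<noteq> 0" using nz poly_eq_0I by blast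
      have "j < ?p"
        using homog_part_weyl_op_negative[OF c(1) deg, of P ?p j] j P FH unfolding c(2)
        by (meson not_le subsetD)
      have linf: "linear_between fun_scale F fun_scale (H j) (\<lambda>Q. homog_part j (D Q))"
        by (rule linear_between_mono[OF linear_between_compose[OF lin homog_part_linear] FA])
          (use FA linear_between_in[OF lin] homog_part_in in blast)
      have equi: "homog_part j (D (act g Q)) = act g (homog_part j (D Q))" if "g \<in> carrier G" "Q \<in> F" for g Q
        using inv homog_part_act linear_between_in[OF lin] FA that by (metis subsetD)
      note emb = irreducible_rep_embedding[where f = "\<lambda>Q. homog_part j (D Q)" and \<tau> = act and \<tau>' = act,
          OF G.group_axioms irrF homog_rep linf equi P j]
      have "?p \<le> j" by (rule first_degree_le[OF emb(2) iso_rep_trans[OF F(2) emb(3)]])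
      then show False using \<open>j < ?p\<close> by simp
    qed
    then show ?thesis unfolding polynomial_model_def using P FA by blast
  qed
  then show ?thesis
    unfolding first_component_def isotypical_component_def
    by (intro fs.span_minimal polynomial_model_subspace) blast
qed

text \<open>Induction on the dimension of \<open>E\<close>: a Maschke projection
  \<open>\<pi>\<close> splits off an irreducible \<open>F\<close>, leaving its kernel in
  \<open>E\<close>. Passing to subrepresentations \<open>E\<close> of the fixed \<open>H m\<close>
  keeps the annihilation hypothesis in terms of all of \<open>H m\<close>.\<close>

lemma annihilated_in_span_first_components:
  assumes R: "irrep_representatives G R"
    and "subrep G fun_scale E (H m) act" "P \<in> E" "\<And>\<phi>. intertwines_down m \<phi> \<Longrightarrow> \<phi> P = 0"
  shows "P \<in> fs.span (\<Union>U\<in>R. first_component G sc bs \<rho> U)"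
  using assms(2-)
proof (induction "fs.dim E" arbitrary: E P rule: less_induct)
  case less
  obtain T where T: "finite T" "H m = fs.span T" using homog_funs_finite_span by blast
  have E: "E \<subseteq> fs.span T" "fs.subspace E" using less.prems(1) T(2) unfolding subrep_def by blast+
  have grE: "group_rep G fun_scale E act" by (rule group_rep_subrep[OF homog_rep less.prems(1)])
  show ?case
  proof (cases "E = {0}")
    case True
    then show ?thesis using less.prems(2) by (simp add: fs.span_zero)
  next
    case False
    obtain F where F: "subrep G fun_scale F E act" "irreducible_rep G fun_scale F act"
      using exists_irreducible_subrep[OF T(1) E(1) grE False] by blast
    have FH: "subrep G fun_scale F (H m) act" by (rule subrep_trans[OF less.prems(1) F(1)])
    have FE: "F \<subseteq> E" "F \<subseteq> H m" "fs.subspace F" using F(1) FH unfolding subrep_def by blast+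
    have FU: "subrep G fun_scale F UNIV act" by (rule subrep_trans[OF homog_subrep FH])
    have grF: "group_rep G fun_scale F act" using F(2) unfolding irreducible_rep_def by blast
    obtain \<pi> where \<pi>: "linear_between fun_scale UNIV fun_scale F \<pi>" "\<forall>x\<in>F. \<pi> x = x"
      "\<forall>g\<in>carrier G. \<forall>x. \<pi> (act g x) = act g (\<pi> x)"
      using maschke_projection[OF G.group_axioms finite_group act_rep FU] by blast
    have \<pi>F: "\<pi> x \<in> F" for x using linear_between_in[OF \<pi>(1)] by blast
    have \<pi>H: "linear_between fun_scale (H m) fun_scale F \<pi>"
      by (rule linear_between_mono[OF \<pi>(1)]) (use \<pi>F in auto)
    obtain U0 where U0: "U0 \<in> irreps G" "iso_rep G fun_scale (fst U0) (snd U0) fun_scale F act"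
      using exists_model_rep[OF FH F(2)] by blast
    obtain U where U: "U \<in> R" "iso_rep G fun_scale (fst U0) (snd U0) fun_scale (fst U) (snd U)"
      using R U0(1) unfolding irrep_representatives_def by blast
    have "group_rep G fun_scale (fst U0) (snd U0)"
      using U0(1) unfolding irreps_def irreducible_rep_def by blast
    then have isoU: "iso_rep G fun_scale (fst U) (snd U) fun_scale F act"
      using iso_rep_trans[OF iso_rep_sym[OF U(2)] U0(2)] by blast
    let ?p = "first_degree G sc bs \<rho> U"
    have \<pi>P: "\<pi> P \<in> fs.span (\<Union>U\<in>R. first_component G sc bs \<rho> U)"
    proof (cases "?p = m")
      case True
      have "\<pi> P \<in> first_component G sc bs \<rho> U"
        unfolding first_component_def isotypical_component_def True
        by (rule fs.span_base) (use \<pi>F FH isoU in blast)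
      then show ?thesis using U(1) by (intro fs.span_base) blast
    next
      case False
      \<comment> \<open>\<open>F\<close> has a copy in the lower degree \<open>?p\<close>. Following
        \<open>\<pi>\<close> by the isomorphism gives a map that must kill \<open>P\<close>, and
        injectivity of the isomorphism yields \<open>\<pi> P = 0\<close>.\<close>
      then have "?p < m" using first_degree_le[OF FH isoU] by simp
      obtain F' where F': "subrep G fun_scale F' (H ?p) act"
        "iso_rep G fun_scale (fst U) (snd U) fun_scale F' act"
        using first_degree_realized[OF FH isoU] by blast
      have "group_rep G fun_scale (fst U) (snd U)"
        using U(1) R unfolding irrep_representatives_def irreps_def irreducible_rep_def by blast
      then have "iso_rep G fun_scale F act fun_scale F' act"
        using iso_rep_trans[OF iso_rep_sym[OF isoU] F'(2)] by blast
      then obtain f where f: "bij_betw f F F'" "linear_between fun_scale F fun_scale F' f"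
        "\<forall>g\<in>carrier G. \<forall>x\<in>F. f (act g x) = act g (f x)"
        unfolding iso_rep_def by blast
      have "linear_between fun_scale (H m) fun_scale F' (\<lambda>x. f (\<pi> x))"
        by (rule linear_between_compose[OF \<pi>H f(2)])
      moreover have "F' \<subseteq> H ?p" using F'(1) unfolding subrep_def by blast
      ultimately have "linear_between fun_scale (H m) fun_scale (H ?p) (\<lambda>x. f (\<pi> x))"
        unfolding linear_between_def by blast
      then have "intertwines_down m (\<lambda>x. f (\<pi> x))"
        unfolding intertwines_down_def using \<open>?p < m\<close> \<pi>(3) f(3) \<pi>F by auto
      then have "f (\<pi> P) = 0" by (rule less.prems(3))
      moreover have "f 0 = 0" by (rule linear_between_zero[OF f(2) vector_space_fun_scale FE(3)])
      ultimately have "\<pi> P = 0"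
        using inj_onD[OF bij_betw_imp_inj_on[OF f(1)], of "\<pi> P" 0] \<pi>F fs.subspace_0[OF FE(3)] by simp
      then show ?thesis by (simp add: fs.span_zero)
    qed
    define E' where "E' = {x \<in> E. \<pi> x = 0}"
    have EU: "linear_between fun_scale E fun_scale F \<pi>"
      by (rule linear_between_mono[OF \<pi>(1)]) (use \<pi>F in auto)
    have E'sub: "fs.subspace E'"
      unfolding E'_def
      by (rule linear_between_kernel_subspace[OF EU vector_space_fun_scale vector_space_fun_scale E(2)])
    have act0: "act g 0 = 0" if "g \<in> carrier G" for g
      using linear_between_zero[OF act_linear[OF that] vector_space_fun_scale fs.subspace_UNIV] .
    have "act g x \<in> E'" if "g \<in> carrier G" "x \<in> E'" for g x
      using that \<pi>(3) act0 group_rep_in[OF grE] unfolding E'_def by auto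
    then have "subrep G fun_scale E' E act"
      unfolding subrep_def using E'sub unfolding E'_def by blast
    then have E'H: "subrep G fun_scale E' (H m) act" by (rule subrep_trans[OF less.prems(1)])
    \<comment> \<open>A nonzero vector of \<open>F\<close> is fixed by \<open>\<pi>\<close>, so the
      kernel is strictly smaller than \<open>E\<close>.\<close>
    obtain x where "x \<in> F" "x \<noteq> 0"
      using F(2) fs.subspace_0[OF FE(3)] unfolding irreducible_rep_def by blast
    then have "x \<in> E" "x \<notin> E'" using FE(1) \<pi>(2) unfolding E'_def by auto
    then have "E' \<subset> E" unfolding E'_def by blast
    then have dim: "fs.dim E' < fs.dim E"
      by (rule dim_strict_subspace[OF vector_space_fun_scale T(1) E(1) E'sub])
    have PE: "\<pi> P \<in> E" using \<pi>F FE(1) by blast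
    have "\<pi> (P - \<pi> P) = 0"
      using linear_between_diff[OF \<pi>(1) vector_space_fun_scale fs.subspace_UNIV] \<pi>(2) \<pi>F by simp
    then have "P - \<pi> P \<in> E'"
      unfolding E'_def using fs.subspace_diff[OF E(2) less.prems(2) PE] by blast
    \<comment> \<open>The hypothesis passes to the remainder because \<open>\<phi>\<close> after
      \<open>\<pi>\<close> is again an equivariant map to a lower degree, so it kills
      \<open>P\<close> too.\<close>
    moreover have "\<phi> (P - \<pi> P) = 0" if \<phi>: "intertwines_down m \<phi>" for \<phi>
    proof -
      obtain k where k: "k < m" "linear_between fun_scale (H m) fun_scale (H k) \<phi>"
        using \<phi> unfolding intertwines_down_def by blast
      have "linear_between fun_scale (H m) fun_scale (H m) \<pi>"
        by (rule linear_between_mono[OF \<pi>(1)]) (use \<pi>F FE(2) in auto)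
      then have "linear_between fun_scale (H m) fun_scale (H k) (\<lambda>x. \<phi> (\<pi> x))"
        using k(2) by (rule linear_between_compose)
      moreover have "\<pi> x \<in> H m" for x using \<pi>F FE(2) by blast
      ultimately have "intertwines_down m (\<lambda>x. \<phi> (\<pi> x))"
        using \<phi> k(1) \<pi>(3) unfolding intertwines_down_def by auto
      then have "\<phi> (\<pi> P) = 0" by (rule less.prems(3))
      moreover have "\<phi> P = 0" by (rule less.prems(3)[OF \<phi>])
      moreover have "P \<in> H m" "\<pi> P \<in> H m" using less.prems(2) PE E(1) T(2) by blast+
      ultimately show ?thesis
        using linear_between_diff[OF k(2) vector_space_fun_scale homog_subspace] by simp
    qed
    ultimately have "P - \<pi> P \<in> fs.span (\<Union>U\<in>R. first_component G sc bs \<rho> U)"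
      by (intro less.hyps[OF dim E'H])
    then have "(P - \<pi> P) + \<pi> P \<in> fs.span (\<Union>U\<in>R. first_component G sc bs \<rho> U)"
      using \<pi>P by (rule fs.span_add)
    then show ?thesis by simp
  qed
qed

lemma polynomial_model_eq_span:
  assumes R: "irrep_representatives G R"
  shows "polynomial_model G sc bs \<rho> = fs.span (\<Union>U\<in>R. first_component G sc bs \<rho> U)"
proof
  show "polynomial_model G sc bs \<rho> \<subseteq> fs.span (\<Union>U\<in>R. first_component G sc bs \<rho> U)"
  proof
    fix P assume P: "P \<in> polynomial_model G sc bs \<rho>"
    then have PA: "P \<in> A" unfolding polynomial_model_def by blast
    obtain N where N: "P = (\<Sum>m<N. homog_part m P)" using poly_eq_sum_homog_part[OF PA] by blast
    have "homog_part m P \<in> fs.span (\<Union>U\<in>R. first_component G sc bs \<rho> U)" for m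
      by (rule annihilated_in_span_first_components[OF R subrep_refl[OF homog_rep] homog_part_in[OF PA]])
        (rule polynomial_model_homog_part_annihilated[OF P])
    then have "(\<Sum>m<N. homog_part m P) \<in> fs.span (\<Union>U\<in>R. first_component G sc bs \<rho> U)"
      by (intro fs.span_sum)
    then show "P \<in> fs.span (\<Union>U\<in>R. first_component G sc bs \<rho> U)" using N by simp
  qed
  show "fs.span (\<Union>U\<in>R. first_component G sc bs \<rho> U) \<subseteq> polynomial_model G sc bs \<rho>"
  proof (rule fs.span_minimal[OF _ polynomial_model_subspace], rule UN_least)
    fix U assume "U \<in> R"
    then have "irreducible_rep G fun_scale (fst U) (snd U)"
      using R unfolding irrep_representatives_def irreps_def by blast
    then show "first_component G sc bs \<rho> U \<subseteq> polynomial_model G sc bs \<rho>"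
      by (rule first_component_subset_model)
  qed
qed

text \<open>A nonzero intersection would contain an irreducible \<open>F\<close>. By
  \<open>irreducible_in_span_iso\<close> this \<open>F\<close> is isomorphic to \<open>U0\<close>
  and to some other member of \<open>R\<close>, against uniqueness of representatives.\<close>

lemma first_components_independent:
  assumes R: "irrep_representatives G R"
    and U0: "U0 \<in> R" "P \<in> first_component G sc bs \<rho> U0"
      "P \<in> fs.span (\<Union>U\<in>R - {U0}. first_component G sc bs \<rho> U)"
  shows "P = 0"
proof (rule ccontr)
  assume "P \<noteq> 0"
  let ?p = "first_degree G sc bs \<rho>"
  define \<F> where "\<F> U = {F. subrep G fun_scale F (H (?p U)) act \<and>
    iso_rep G fun_scale (fst U) (snd U) fun_scale F act}" for U :: "'g model_rep"
  have irr: "irreducible_rep G fun_scale (fst U) (snd U)" if "U \<in> R" for U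
    using R that unfolding irrep_representatives_def irreps_def by blast
  have fc: "first_component G sc bs \<rho> U = fs.span (\<Union>(\<F> U))" for U
    unfolding first_component_def isotypical_component_def \<F>_def ..
  have \<F>U: "subrep G fun_scale F UNIV act" if "F \<in> \<F> U" for F U
    using subrep_trans[OF homog_subrep] that unfolding \<F>_def by blast
  have \<F>irr: "irreducible_rep G fun_scale F act" if "F \<in> \<F> U" "U \<in> R" for F U
    using iso_rep_irreducible[OF _ irr[OF that(2)] vector_space_fun_scale G.group_axioms] that(1)
    unfolding \<F>_def by blast
  let ?\<G> = "\<Union>U\<in>R - {U0}. \<F> U"
  have sub1: "subrep G fun_scale (fs.span (\<Union>(\<F> U0))) UNIV act"
    by (rule span_subrep[OF act_rep]) (rule \<F>U)
  have sub2: "subrep G fun_scale (fs.span (\<Union>?\<G>)) UNIV act"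
    by (rule span_subrep[OF act_rep]) (use \<F>U in blast)
  define X where "X = fs.span (\<Union>(\<F> U0)) \<inter> fs.span (\<Union>?\<G>)"
  have X: "subrep G fun_scale X UNIV act"
    unfolding subrep_def
  proof (intro conjI ballI)
    show "fs.subspace X"
      using sub1 sub2 unfolding X_def subrep_def by (intro fs.subspace_inter) simp_all
    fix g assume "g \<in> carrier G"
    then show "act g ` X \<subseteq> X" using sub1 sub2 unfolding X_def subrep_def by fast
  qed simp
  have "fs.span (\<Union>U\<in>R - {U0}. first_component G sc bs \<rho> U) \<subseteq> fs.span (\<Union>?\<G>)"
    unfolding fc
  proof (rule fs.span_minimal[OF _ fs.subspace_span], rule UN_least)
    fix U assume "U \<in> R - {U0}"
    then show "fs.span (\<Union>(\<F> U)) \<subseteq> fs.span (\<Union>?\<G>)" by (intro fs.span_mono) blast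
  qed
  then have "P \<in> X" using U0(2,3) unfolding X_def fc by blast
  then have "X \<noteq> {0}" using \<open>P \<noteq> 0\<close> by blast
  obtain T where T: "finite T" "H (?p U0) = fs.span T" using homog_funs_finite_span by blast
  \<comment> \<open>The span of the other components may involve many degrees, but that of
    \<open>U0\<close> lies in one graded piece; this makes the intersection
    finite-dimensional.\<close>
  have "fs.span (\<Union>(\<F> U0)) \<subseteq> H (?p U0)"
    by (rule fs.span_minimal[OF _ homog_subspace]) (auto simp: \<F>_def subrep_def)
  then have "X \<subseteq> fs.span T" unfolding X_def T(2)[symmetric] by blast
  then obtain F where F: "subrep G fun_scale F X act" "irreducible_rep G fun_scale F act"
    using exists_irreducible_subrep[OF T(1) _ group_rep_subrep[OF act_rep X] \<open>X \<noteq> {0}\<close>] by blast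
  have FU: "subrep G fun_scale F UNIV act" by (rule subrep_trans[OF X F(1)])
  have FX: "F \<subseteq> fs.span (\<Union>(\<F> U0))" "F \<subseteq> fs.span (\<Union>?\<G>)"
    using F(1) unfolding subrep_def X_def by blast+
  have "\<exists>F'\<in>\<F> U0. iso_rep G fun_scale F' act fun_scale F act"
    by (rule irreducible_in_span_iso[OF G.group_axioms finite_group act_rep FU F(2) FX(1)])
      (use \<F>irr U0(1) in blast)
  then have iso0: "iso_rep G fun_scale (fst U0) (snd U0) fun_scale F act"
    unfolding \<F>_def using iso_rep_trans by blast
  have "\<exists>F'\<in>?\<G>. iso_rep G fun_scale F' act fun_scale F act"
    by (rule irreducible_in_span_iso[OF G.group_axioms finite_group act_rep FU F(2) FX(2)])
      (use \<F>irr in blast)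
  then obtain U where U: "U \<in> R" "U \<noteq> U0" "iso_rep G fun_scale (fst U) (snd U) fun_scale F act"
    unfolding \<F>_def using iso_rep_trans by blast
  have "iso_rep G fun_scale (fst U0) (snd U0) fun_scale (fst U) (snd U)"
    using iso_rep_trans[OF iso0 iso_rep_sym[OF U(3)]] irr[OF U(1)] unfolding irreducible_rep_def by blast
  moreover have "iso_rep G fun_scale (fst U0) (snd U0) fun_scale (fst U0) (snd U0)"
    by (rule iso_rep_refl)
  moreover have "\<exists>!U'\<in>R. iso_rep G fun_scale (fst U0) (snd U0) fun_scale (fst U') (snd U')"
    using R U0(1) unfolding irrep_representatives_def by blast
  ultimately show False using U(1,2) U0(1) by blast
qed

end

theorem theorem2p4:
  fixes G :: "('g, 'r) monoid_scheme"
    and sc :: "complex \<Rightarrow> 'v::ab_group_add \<Rightarrow> 'v"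
    and bs :: "'v list"
    and \<rho> :: "'g \<Rightarrow> 'v \<Rightarrow> 'v"
    and R :: "'g model_rep set"
  assumes "group G" and "finite (carrier G)"
    and "finite_dimensional_vector_space sc (set bs)" and "distinct bs"
    and "group_rep G sc UNIV \<rho>" and "inj_on \<rho> (carrier G)"
    and "irrep_representatives G R"
  shows "internal_direct_sum fun_scale R (first_component G sc bs \<rho>) (polynomial_model G sc bs \<rho>)"
proof -
  interpret polynomial_rep sc bs G \<rho>
    using assms by (simp add: polynomial_rep_def polynomial_rep_axioms_def based_space_def
        based_space_axioms_def)
  show ?thesis
  proof (rule internal_direct_sumI[OF vector_space_fun_scale])
    show "fs.subspace (first_component G sc bs \<rho> U)" for U
      unfolding first_component_def isotypical_component_def by (rule fs.subspace_span)
    show "polynomial_model G sc bs \<rho> = fs.span (\<Union>U\<in>R. first_component G sc bs \<rho> U)"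
      by (rule polynomial_model_eq_span[OF assms(7)])
  qed (rule first_components_independent[OF assms(7)])
qed

end
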